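(* For $a\in\mathbb{Z}_{\geq -1}$ let $\rho$ be the largest root of $x^3-ax^2-(a+3)x-1$ and $K=\mathbb{Q}(\rho)$, and consider those $a$ for which $\mathcal{O}_K=\mathbb{Z}[\rho]$. For $X\in\mathbb{R}$ let $\mathcal{P}_a(X)$ be the number of primitive principal ideals $I$ of $\mathcal{O}_K$ with norm $N(I)\leq X$. Let $\delta\in[0,1]$. Then $$\mathcal{P}_a(a^{1+\delta})\asymp a^{2\delta/3}.$$
   Context: An ideal $I$ of $\mathcal{O}_K$ is primitive if $n\nmid I$ for all integers $n\geq 2$ (i.e. $I\not\subseteq n\mathcal{O}_K$). The notation $f\asymp g$ means $f\ll g$ and $g\ll f$, where $f\ll g$ means that there is a constant $C$ with $|f(a)|<Cg(a)$ for all sufficiently large $a$; here $a$ runs over the integers $a\geq -1$ for which $\mathcal{O}_K=\mathbb{Z}[\rho]$. *)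

theory Defs
  imports
    "HOL-Algebra.Algebra"
    "HOL-Algebra.Algebraic_Closure_Type"
    "HOL-Library.Landau_Symbols"
begin

definition rho :: "int \<Rightarrow> real" where
  "rho a = Max {x :: real. x ^ 3 - of_int a * x ^ 2 - (of_int a + 3) * x - 1 = 0}"

text \<open>The field \<open>K = \<rat>(\<rho>)\<close>, its ring of integers and the order \<open>\<int>[\<rho>]\<close> are taken
  inside the real numbers.\<close>

definition field_K :: "int \<Rightarrow> real set" where
  "field_K a = generate_field ring_of_type_algebra {rho a}"

definition O_K :: "int \<Rightarrow> real ring" where
  "O_K a = (ring_of_type_algebra :: real ring)\<lparr>carrier := {x \<in> field_K a. algebraic_int x}\<rparr>"

definition Z_rho :: "int \<Rightarrow> real set" where
  "Z_rho a = generate_ring ring_of_type_algebra {rho a}"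

definition primitive_ideal :: "int \<Rightarrow> real set \<Rightarrow> bool" where
  "primitive_ideal a I \<longleftrightarrow>
     ideal I (O_K a) \<and> (\<forall>n::int. n \<ge> 2 \<longrightarrow> \<not> I \<subseteq> PIdl\<^bsub>O_K a\<^esub> (of_int n))"

text \<open>The index of \<open>I\<close>. The zero ideal has infinite index, so it gets the value \<open>0\<close>, which is its
  usual norm.\<close>

definition ideal_norm :: "int \<Rightarrow> real set \<Rightarrow> nat" where
  "ideal_norm a I = card (carrier (O_K a Quot I))"

definition primitive_principal_count :: "int \<Rightarrow> real \<Rightarrow> nat" where
  "primitive_principal_count a y =
     card {I. principalideal I (O_K a) \<and> primitive_ideal a I \<and> real (ideal_norm a I) \<le> y}"

definition monogenic_params :: "int set" where
  "monogenic_params = {a. a \<ge> -1 \<and> carrier (O_K a) = Z_rho a}"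

end

theory Submission
  imports Defs
begin

text \<open>Write \<open>\<rho>, \<rho>', \<rho>''\<close> for the three roots; they have sizes about \<open>a, 1, 1/a\<close>, and they are units.
  Put \<open>t = a powr (\<delta> / 3)\<close>, so that the norm bound is \<open>a * t ^ 3\<close>. For \<open>A = x + y * \<rho> + z * \<rho>\<^sup>2\<close> and
  \<open>w = y + a * z\<close> the differences of the conjugates of \<open>A\<close> are about \<open>a * w\<close>, \<open>a * z\<close> and \<open>a * (w + z)\<close>
  in absolute value. In particular an irrational element has a conjugate of size at least \<open>a / 4\<close>.

  Upper bound: multiplying by units, one can choose a generator of every ideal all of whose conjugates
  are \<open>O(a * t)\<close>, so \<open>w\<close> and \<open>z\<close> are \<open>O(t)\<close>. If \<open>w, z, w + z\<close> are all nonzero, then the three conjugates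
  are far apart and only \<open>O(1)\<close> values of \<open>x\<close> are possible. On each of the three degenerate lines,
  with parameter \<open>k\<close>, there are \<open>O(1 + sqrt (t ^ 3 / k))\<close> values of \<open>x\<close>, and the sum of these over \<open>k = O(t)\<close>
  is \<open>O(t\<^sup>2)\<close>.

  Lower bound: for coprime \<open>1 \<le> x, y \<le> t / 3\<close> the elements \<open>y * \<rho> - x\<close> are primitive of norm at most
  \<open>a * t ^ 3\<close>. A quotient of two of them that is a unit has conjugates of size \<open>O(t) < a / 4\<close>, hence is
  rational and equal to \<open>1\<close> or \<open>-1\<close>, so they generate distinct ideals.\<close>

section \<open>The roots and conjugate triples\<close>

text \<open>Multiplying the equation for \<open>s\<close> by \<open>r ^ 3\<close> and inserting
  \<open>r * s = - r - 1\<close> yields minus the equation for \<open>r\<close>. This map of order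
  three on the roots makes the cubic cyclic.\<close>

lemma conj_cubic:
  fixes r s a :: real
  assumes "r ^ 3 = a * r\<^sup>2 + (a + 3) * r + 1" "r \<noteq> 0" "s = - 1 - 1 / r"
  shows "s ^ 3 = a * s\<^sup>2 + (a + 3) * s + 1"
proof -
  have s: "r * s = - r - 1"
    using assms(2,3) by (simp add: field_simps)
  have "r ^ 3 * (s ^ 3 - (a * s\<^sup>2 + (a + 3) * s + 1))
    = (r * s) ^ 3 - (a * r * (r * s)\<^sup>2 + (a + 3) * r\<^sup>2 * (r * s) + r ^ 3)"
    by (simp add: algebra_simps power2_eq_square power3_eq_cube)
  also have "\<dots> = - (r ^ 3 - (a * r\<^sup>2 + (a + 3) * r + 1))"
    unfolding s using assms(1) by (simp add: algebra_simps power2_eq_square power3_eq_cube)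
  also have "\<dots> = 0"
    using assms(1) by simp
  finally show ?thesis
    using assms(2) by simp
qed

text \<open>The threshold 1000 gives the later estimates their slack; an asymptotic statement
  ignores smaller \<open>a\<close>. Explicit formulas for \<open>r2\<close> and \<open>r3\<close> in
  terms of \<open>r1\<close> make the Galois action computable.\<close>

locale simplest_cubic =
  fixes a :: int and r1 r2 r3 :: real
  assumes a_ge: "a \<ge> 1000"
    and r1_eq: "r1 = rho a"
    and r2_eq: "r2 = - 1 - 1 / r1"
    and r3_eq: "r3 = - 1 / (1 + r1)"
begin

abbreviation ra :: real where "ra \<equiv> of_int a"

lemma real_a_ge: "ra \<ge> 1000"
  using a_ge by linarith

text \<open>As \<open>rho\<close> is a \<open>Max\<close>, all real roots must be known. A sign
  change gives a root between \<open>ra + 1\<close> and \<open>ra + 2\<close>; factoring the cubic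
  through its two images shows that the others are smaller.\<close>

lemma rho_spec:
  shows rho_cubic: "r1 ^ 3 = ra * r1\<^sup>2 + (ra + 3) * r1 + 1"
    and r1_gt: "r1 > ra + 1" and r1_lt: "r1 < ra + 2"
proof -
  let ?f = "\<lambda>x::real. x ^ 3 - ra * x ^ 2 - (ra + 3) * x - 1"
  have "?f (ra + 1) = - 2 * (ra + 1) - 1"
    by (simp add: algebra_simps power2_eq_square power3_eq_cube)
  then have lo: "?f (ra + 1) < 0"
    using real_a_ge by simp
  have "?f (ra + 2) = (ra + 2) * (ra + 1) - (1::real)"
    by (simp add: algebra_simps power2_eq_square power3_eq_cube)
  moreover have "(ra + 2) * (ra + 1) \<ge> (2::real) * 1"
    using real_a_ge by (intro mult_mono) auto
  ultimately have hi: "?f (ra + 2) > 0"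
    by linarith
  have "\<exists>r. ra + 1 \<le> r \<and> r \<le> ra + 2 \<and> ?f r = 0"
    by (rule IVT') (use lo hi in \<open>auto intro!: continuous_intros\<close>)
  then obtain r where r: "ra + 1 \<le> r" "r \<le> ra + 2" "?f r = 0"
    by blast
  have rne: "r \<noteq> ra + 1" "r \<noteq> ra + 2"
    using r(3) lo hi by auto
  have rpos: "r > 0" "1 + r > 0"
    using r(1) real_a_ge by auto
  define s t where "s = - 1 - 1 / r" and "t = - 1 / (1 + r)"
  \<comment> \<open>The cubic is linear in \<open>ra\<close>, so after multiplication by
    \<open>r^2 + r\<close> the parameter can be eliminated, which leaves a polynomial identity in
    \<open>x\<close> and \<open>r\<close>.\<close>
  have a_r: "ra * (r\<^sup>2 + r) = r ^ 3 - 3 * r - 1"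
    using r(3) by (simp add: algebra_simps)
  have fact: "(r\<^sup>2 + r) * ?f x = (r\<^sup>2 + r) * ((x - r) * (x - s) * (x - t))" for x
  proof -
    have "(r\<^sup>2 + r) * ?f x = (r\<^sup>2 + r) * (x ^ 3 - 3 * x - 1) - (x\<^sup>2 + x) * (ra * (r\<^sup>2 + r))"
      by (simp add: algebra_simps)
    also have "\<dots> = (r\<^sup>2 + r) * (x ^ 3 - 3 * x - 1) - (x\<^sup>2 + x) * (r ^ 3 - 3 * r - 1)"
      by (simp only: a_r)
    also have "\<dots> = (x - r) * (r * x + r + 1) * ((1 + r) * x + 1)"
      by (simp add: algebra_simps power2_eq_square power3_eq_cube)
    also have "r * x + r + 1 = r * (x - s)"
      using rpos by (simp add: s_def field_simps)
    also have "(1 + r) * x + 1 = (1 + r) * (x - t)"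
      using rpos by (simp add: t_def field_simps)
    finally show ?thesis
      by (simp add: algebra_simps power2_eq_square)
  qed
  have "r\<^sup>2 + r \<noteq> 0"
    using rpos by (smt (verit) zero_le_power2)
  then have "?f x = (x - r) * (x - s) * (x - t)" for x
    using fact[of x] by (simp only: mult_cancel_left) simp
  then have "{x. ?f x = 0} = {r, s, t}"
    by auto
  then have "rho a = Max {r, s, t}"
    by (simp add: rho_def)
  moreover have "s < r" "t < r"
    using rpos unfolding s_def t_def by (smt (verit) divide_pos_pos divide_minus_left)+
  ultimately have "r1 = r"
    by (simp add: r1_eq max_def)
  then show "r1 ^ 3 = ra * r1\<^sup>2 + (ra + 3) * r1 + 1" "r1 > ra + 1" "r1 < ra + 2"
    using r rne by auto
qed

lemma r1_pos: "r1 > 1000"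
  using r1_gt real_a_ge by linarith

lemma r2_bounds: "- 2 < r2" "r2 < - 1"
  using r1_pos by (auto simp: r2_eq field_simps)

lemma r3_bounds: "- 1 / ra < r3" "r3 < 0"
proof -
  have "1 / (1 + r1) < 1 / ra"
    using r1_gt real_a_ge by (intro divide_strict_left_mono) auto
  then show "- 1 / ra < r3"
    by (simp add: r3_eq)
  show "r3 < 0"
    using r1_pos by (simp add: r3_eq)
qed

lemma r3_alt: "r3 = - 1 - 1 / r2"
  using r1_pos by (simp add: r2_eq r3_eq field_simps)

lemma r1_alt: "r1 = - 1 - 1 / r3"
  using r1_pos by (simp add: r3_eq field_simps)

lemma r2_cubic: "r2 ^ 3 = ra * r2\<^sup>2 + (ra + 3) * r2 + 1"
  using conj_cubic[OF rho_cubic _ r2_eq] r1_pos by simp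

lemma r3_cubic: "r3 ^ 3 = ra * r3\<^sup>2 + (ra + 3) * r3 + 1"
  using conj_cubic[OF r2_cubic _ r3_alt] r2_bounds by simp

lemma prod_roots: "r1 * r2 * r3 = 1"
  using r1_pos by (simp add: r2_eq r3_eq field_simps)

lemma sum_roots: "r1 + r2 + r3 = ra"
proof -
  have "r1 * (1 + r1) * (r1 + r2 + r3 - ra)
      = r1 * (1 + r1) * (r1 - ra) + (1 + r1) * (r1 * r2) + r1 * ((1 + r1) * r3)"
    by (simp add: algebra_simps)
  also have "r1 * r2 = - r1 - 1"
    using r1_pos by (simp add: r2_eq field_simps)
  also have "(1 + r1) * r3 = - 1"
    using r1_pos by (simp add: r3_eq)
  also have "r1 * (1 + r1) * (r1 - ra) + (1 + r1) * (- r1 - 1) + r1 * - 1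
      = r1 ^ 3 - (ra * r1\<^sup>2 + (ra + 3) * r1 + 1)"
    by (simp add: algebra_simps power2_eq_square power3_eq_cube)
  also have "\<dots> = 0" using rho_cubic by simp
  finally show ?thesis
    using r1_pos by auto
qed

text \<open>The cubic gives \<open>1 / r = r^2 - ra * r - (ra + 3)\<close>, so the next root is a
  polynomial in \<open>r\<close>, with the same coefficients for each of the three roots.\<close>

lemma next_root:
  fixes r s :: real
  assumes "r ^ 3 = ra * r\<^sup>2 + (ra + 3) * r + 1" "r \<noteq> 0" "s = - 1 - 1 / r"
  shows "s = ra + 2 + ra * r - r\<^sup>2"
    and "s\<^sup>2 = (ra\<^sup>2 + 3 * ra + 4) + (ra\<^sup>2 + ra + 1) * r - (ra + 1) * r\<^sup>2"
proof -
  have s: "r * s = - r - 1"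
    using assms(2,3) by (simp add: field_simps)
  have "r * (s - (ra + 2 + ra * r - r\<^sup>2)) = r ^ 3 - (ra * r\<^sup>2 + (ra + 3) * r + 1)"
    using s by (simp add: algebra_simps power2_eq_square power3_eq_cube)
  then show *: "s = ra + 2 + ra * r - r\<^sup>2"
    using assms(1,2) by simp
  have c: "r * (r * r) = ra * (r * r) + (ra + 3) * r + 1"
    using assms(1) by (simp add: power2_eq_square power3_eq_cube)
  have "s\<^sup>2 = (ra + 2)\<^sup>2 + 2 * ra * (ra + 2) * r + (ra\<^sup>2 - 2 * (ra + 2)) * r\<^sup>2 - 2 * ra * (r * (r * r))
      + r * (r * (r * r))"
    unfolding * by (simp add: algebra_simps power2_eq_square)
  also have "r * (r * (r * r)) = ra * (r * (r * r)) + (ra + 3) * r\<^sup>2 + r"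
    by (subst c) (simp add: algebra_simps power2_eq_square)
  finally show "s\<^sup>2 = (ra\<^sup>2 + 3 * ra + 4) + (ra\<^sup>2 + ra + 1) * r - (ra + 1) * r\<^sup>2"
    unfolding c by (simp add: algebra_simps power2_eq_square)
qed

section \<open>Coordinates and arithmetic of conjugate triples\<close>

definition ev :: "real \<Rightarrow> int \<Rightarrow> int \<Rightarrow> int \<Rightarrow> real" where
  "ev r x y z = x + y * r + z * r\<^sup>2"

text \<open>\<open>conj3 A B C\<close>: the element \<open>A\<close> of \<open>\<int>[\<rho>]\<close> has the further conjugates \<open>B\<close> and \<open>C\<close>. The Galois group acts by
  \<open>r \<mapsto> - 1 - 1 / r\<close>, that is, by rotating the triple.\<close>

definition conj3 :: "real \<Rightarrow> real \<Rightarrow> real \<Rightarrow> bool" where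
  "conj3 A B C \<longleftrightarrow> (\<exists>x y z. A = ev r1 x y z \<and> B = ev r2 x y z \<and> C = ev r3 x y z)"

lemma conj3_ev [intro]: "conj3 (ev r1 x y z) (ev r2 x y z) (ev r3 x y z)"
  by (auto simp: conj3_def)

lemma conj3_of_int [intro]: "conj3 (of_int n) (of_int n) (of_int n)"
  unfolding conj3_def by (intro exI[of _ n] exI[of _ 0]) (simp add: ev_def)

lemma conj3_1 [intro]: "conj3 1 1 1"
  using conj3_of_int[of 1] by simp

lemma conj3_roots [intro]: "conj3 r1 r2 r3"
  unfolding conj3_def by (intro exI[of _ 0] exI[of _ 1]) (simp add: ev_def)

lemma conj3_add [intro]:
  assumes "conj3 A B C" "conj3 A' B' C'"
  shows "conj3 (A + A') (B + B') (C + C')"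
proof -
  obtain x y z x' y' z' where
    "A = ev r1 x y z" "B = ev r2 x y z" "C = ev r3 x y z"
    "A' = ev r1 x' y' z'" "B' = ev r2 x' y' z'" "C' = ev r3 x' y' z'"
    using assms by (auto simp: conj3_def)
  moreover have "ev r x y z + ev r x' y' z' = ev r (x + x') (y + y') (z + z')" for r
    by (simp add: ev_def algebra_simps)
  ultimately show ?thesis
    by auto
qed

lemma conj3_minus [intro]:
  assumes "conj3 A B C"
  shows "conj3 (- A) (- B) (- C)"
proof -
  obtain x y z where
    "A = ev r1 x y z" "B = ev r2 x y z" "C = ev r3 x y z"
    using assms by (auto simp: conj3_def)
  moreover have "- ev r x y z = ev r (- x) (- y) (- z)" for r
    by (simp add: ev_def algebra_simps)
  ultimately show ?thesis
    by auto
qed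

lemma conj3_diff [intro]:
  assumes "conj3 A B C" "conj3 A' B' C'"
  shows "conj3 (A - A') (B - B') (C - C')"
  using conj3_add[OF assms(1) conj3_minus[OF assms(2)]] by simp

text \<open>Reducing \<open>r ^ 3\<close> and \<open>r ^ 4\<close> by the cubic gives coordinates
  that do not mention the root. The same integers serve all three conjugates, which is why triples
  multiply componentwise.\<close>

lemma ev_mult:
  assumes "r ^ 3 = ra * r\<^sup>2 + (ra + 3) * r + 1"
  shows "ev r x y z * ev r x' y' z' =
    ev r (x * x' + (y * z' + z * y') + a * (z * z'))
         (x * y' + y * x' + (a + 3) * (y * z' + z * y') + (a\<^sup>2 + 3 * a + 1) * (z * z'))
         (x * z' + y * y' + z * x' + a * (y * z' + z * y') + (a\<^sup>2 + a + 3) * (z * z'))"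
proof -
  have "ev r x y z * ev r x' y' z' = x * x' + (x * y' + y * x') * r + (x * z' + y * y' + z * x') * r\<^sup>2
      + (y * z' + z * y') * r ^ 3 + z * z' * (r * r ^ 3)"
    by (simp add: ev_def algebra_simps power2_eq_square power3_eq_cube)
  also have "r * r ^ 3 = ra * r ^ 3 + (ra + 3) * r\<^sup>2 + r"
    by (subst assms) (simp add: algebra_simps power2_eq_square power3_eq_cube)
  finally show ?thesis
    unfolding assms by (simp add: ev_def algebra_simps power2_eq_square)
qed

lemma conj3_mult [intro]:
  assumes "conj3 A B C" "conj3 A' B' C'"
  shows "conj3 (A * A') (B * B') (C * C')"
proof -
  obtain x y z x' y' z' where
    "A = ev r1 x y z" "B = ev r2 x y z" "C = ev r3 x y z"
    "A' = ev r1 x' y' z'" "B' = ev r2 x' y' z'" "C' = ev r3 x' y' z'"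
    using assms by (auto simp: conj3_def)
  then show ?thesis
    using ev_mult[OF rho_cubic] ev_mult[OF r2_cubic] ev_mult[OF r3_cubic] by auto
qed

lemma conj3_power:
  assumes "conj3 A B C"
  shows "conj3 (A ^ n) (B ^ n) (C ^ n)"
  using assms by (induction n) auto

lemma ev_next:
  assumes "r ^ 3 = ra * r\<^sup>2 + (ra + 3) * r + 1" "r \<noteq> 0" "s = - 1 - 1 / r"
  shows "ev s x y z = ev r (x + (a + 2) * y + (a\<^sup>2 + 3 * a + 4) * z) (a * y + (a\<^sup>2 + a + 1) * z)
    (- y - (a + 1) * z)"
  unfolding ev_def next_root(2)[OF assms] unfolding next_root(1)[OF assms]
  by (simp add: algebra_simps)

text \<open>\<open>ev_next\<close> transforms the coordinates by one integer formula at every root,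
  and the roots form the cycle \<open>r1\<close>, \<open>r2\<close>, \<open>r3\<close>.\<close>

lemma conj3_rot:
  assumes "conj3 A B C"
  shows "conj3 B C A"
proof -
  obtain x y z where "A = ev r1 x y z" "B = ev r2 x y z" "C = ev r3 x y z"
    using assms by (auto simp: conj3_def)
  then show ?thesis
    using ev_next[OF rho_cubic _ r2_eq, of x y z] ev_next[OF r2_cubic _ r3_alt, of x y z]
      ev_next[OF r3_cubic _ r1_alt, of x y z] r1_pos r2_bounds r3_bounds by auto
qed

lemma conj3_rot2: "conj3 A B C \<Longrightarrow> conj3 C A B"
  using conj3_rot by blast

end

section \<open>Indices of principal ideals\<close>

text \<open>Using the operations of the type lets one structure serve both for the elements with
  conjugate triples and for the ring built by \<open>generate_ring\<close>.\<close>

locale subring_of_type =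
  fixes R :: "'a::idom set"
  assumes one_mem: "1 \<in> R"
    and diff_mem: "x \<in> R \<Longrightarrow> y \<in> R \<Longrightarrow> x - y \<in> R"
    and mult_mem: "x \<in> R \<Longrightarrow> y \<in> R \<Longrightarrow> x * y \<in> R"
begin

lemma zero_mem: "0 \<in> R"
  using diff_mem[OF one_mem one_mem] by simp

lemma minus_mem: "x \<in> R \<Longrightarrow> - x \<in> R"
  using diff_mem[OF zero_mem, of x] by simp

lemma add_mem: "x \<in> R \<Longrightarrow> y \<in> R \<Longrightarrow> x + y \<in> R"
  using diff_mem[of x "- y"] minus_mem[of y] by simp

definition eqmod :: "'a \<Rightarrow> 'a \<Rightarrow> 'a \<Rightarrow> bool" where
  "eqmod m x y \<longleftrightarrow> (\<exists>u\<in>R. x - y = m * u)"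

lemma eqmod_refl: "eqmod m x x"
  using zero_mem by (auto simp: eqmod_def)

lemma eqmod_sym: "eqmod m x y \<Longrightarrow> eqmod m y x"
  unfolding eqmod_def by (metis minus_diff_eq[of x y] minus_mem mult_minus_right)

lemma eqmod_trans:
  assumes "eqmod m x y" "eqmod m y z"
  shows "eqmod m x z"
proof -
  obtain u v where "u \<in> R" "v \<in> R" "x - y = m * u" "y - z = m * v"
    using assms by (auto simp: eqmod_def)
  moreover from this have "x - z = m * (u + v)"
    by (simp add: algebra_simps)
  ultimately show ?thesis
    using add_mem by (auto simp: eqmod_def)
qed

definition coset :: "'a \<Rightarrow> 'a \<Rightarrow> 'a set" where
  "coset m x = {y. eqmod m y x}"

text \<open>With infinitely many cosets \<open>card\<close> gives 0, the same convention as in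
  \<open>ideal_norm\<close>.\<close>

definition index :: "'a \<Rightarrow> nat" where
  "index m = card (coset m ` R)"

definition transversal :: "'a \<Rightarrow> 'a set \<Rightarrow> bool" where
  "transversal m T \<longleftrightarrow> T \<subseteq> R \<and> (\<forall>x\<in>R. \<exists>t\<in>T. eqmod m x t) \<and>
     (\<forall>s\<in>T. \<forall>t\<in>T. eqmod m s t \<longrightarrow> s = t)"

lemma coset_eq_iff: "coset m x = coset m y \<longleftrightarrow> eqmod m x y"
proof
  assume "coset m x = coset m y"
  then show "eqmod m x y"
    using eqmod_refl[of m x] by (auto simp: coset_def)
next
  assume "eqmod m x y"
  then show "coset m x = coset m y"
    unfolding coset_def using eqmod_sym[of m] eqmod_trans[of m] by (intro Collect_cong) blast
qed

lemma index_eq_card: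
  assumes "transversal m T"
  shows "index m = card T"
proof -
  have "inj_on (coset m) T"
    using assms by (auto simp: inj_on_def coset_eq_iff transversal_def)
  moreover have "coset m ` T = coset m ` R"
  proof
    show "coset m ` T \<subseteq> coset m ` R"
      using assms by (auto simp: transversal_def)
    show "coset m ` R \<subseteq> coset m ` T"
      using assms by (fastforce simp: transversal_def coset_eq_iff image_iff)
  qed
  ultimately show ?thesis
    unfolding index_def by (metis card_image)
qed

lemma ex_transversal: "\<exists>T. transversal m T"
proof -
  define f where "f x = (SOME t. t \<in> R \<and> eqmod m x t)" for x
  have f: "f x \<in> R" "eqmod m x (f x)" if "x \<in> R" for x
    using someI[of "\<lambda>t. t \<in> R \<and> eqmod m x t" x] that eqmod_refl[of m x] unfolding f_def by auto
  \<comment> \<open>Congruent elements have the same candidates, so \<open>SOME\<close> picks the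
    same representative for both.\<close>
  have feq: "f x = f y" if "eqmod m x y" for x y
  proof -
    have "(\<lambda>t. t \<in> R \<and> eqmod m x t) = (\<lambda>t. t \<in> R \<and> eqmod m y t)"
      using that eqmod_sym eqmod_trans by blast
    then show ?thesis
      unfolding f_def by simp
  qed
  have "transversal m (f ` R)"
    unfolding transversal_def
  proof (intro conjI ballI impI)
    fix s t
    assume "s \<in> f ` R" "t \<in> f ` R" and st: "eqmod m s t"
    then obtain x y where xy: "x \<in> R" "y \<in> R" "s = f x" "t = f y"
      by auto
    then have "eqmod m x y"
      using f st eqmod_sym eqmod_trans by metis
    then show "s = t"
      using feq xy by simp
  qed (use f in auto)
  then show ?thesis
    by blast
qed

text \<open>Between \<open>R\<close> and \<open>m n R\<close> lies \<open>m R\<close>. Since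
  \<open>m\<close> can be cancelled, \<open>m R / m n R\<close> is a copy of \<open>R / n R\<close>,
  so the sums \<open>s + m * t\<close> represent the classes modulo \<open>m * n\<close>.\<close>

lemma index_mult:
  assumes "m \<in> R" "n \<in> R" "m \<noteq> 0"
  shows "index (m * n) = index m * index n"
proof -
  obtain S T where S: "transversal m S" and T: "transversal n T"
    using ex_transversal by meson
  let ?f = "\<lambda>(s, t). s + m * t"
  have SR: "S \<subseteq> R" and TR: "T \<subseteq> R"
    using S T by (auto simp: transversal_def)
  have uniq: "s = s' \<and> t = t'"
    if "s \<in> S" "s' \<in> S" "t \<in> T" "t' \<in> T" and c: "eqmod (m * n) (s + m * t) (s' + m * t')"
    for s s' t t'
  proof -
    obtain u where u: "u \<in> R" "s + m * t - (s' + m * t') = m * n * u"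
      using c by (auto simp: eqmod_def)
    then have "s - s' = m * (t' - t + n * u)"
      by (simp add: algebra_simps)
    moreover have "t' - t + n * u \<in> R"
      using that u assms TR by (auto intro!: add_mem diff_mem mult_mem)
    ultimately have "eqmod m s s'"
      by (auto simp: eqmod_def)
    then have s: "s = s'"
      using S that by (auto simp: transversal_def)
    then have "m * (t - t') = m * (n * u)"
      using u by (simp add: algebra_simps)
    then have "t - t' = n * u"
      using assms(3) by (simp only: mult_cancel_left) simp
    then have "eqmod n t t'"
      using u by (auto simp: eqmod_def)
    then show ?thesis
      using T that s by (auto simp: transversal_def)
  qed
  have "transversal (m * n) (?f ` (S \<times> T))"
    unfolding transversal_def
  proof (intro conjI ballI impI)
    show "?f ` (S \<times> T) \<subseteq> R"
      using SR TR assms by (auto intro!: add_mem mult_mem)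
  next
    fix x
    assume "x \<in> R"
    then obtain s u where s: "s \<in> S" "u \<in> R" "x - s = m * u"
      using S by (auto simp: transversal_def eqmod_def)
    obtain t v where t: "t \<in> T" "v \<in> R" "u - t = n * v"
      using T s(2) by (auto simp: transversal_def eqmod_def)
    have "x - (s + m * t) = m * (u - t)"
      using s(3) by (simp add: algebra_simps)
    then have "x - (s + m * t) = (m * n) * v"
      unfolding t(3) by (simp add: algebra_simps)
    then have "eqmod (m * n) x (s + m * t)"
      using t by (auto simp: eqmod_def)
    then show "\<exists>t\<in>?f ` (S \<times> T). eqmod (m * n) x t"
      using s t by force
  next
    fix p q
    assume "p \<in> ?f ` (S \<times> T)" "q \<in> ?f ` (S \<times> T)" "eqmod (m * n) p q"
    then show "p = q"
      using uniq by auto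
  qed
  then have "index (m * n) = card (?f ` (S \<times> T))"
    by (rule index_eq_card)
  also have "\<dots> = card (S \<times> T)"
  proof (rule card_image, rule inj_onI, clarify)
    fix s t s' t'
    assume "s \<in> S" "t \<in> T" "s' \<in> S" "t' \<in> T" "s + m * t = s' + m * t'"
    then show "s = s' \<and> t = t'"
      using uniq[of s s' t t'] eqmod_refl[of "m * n" "s + m * t"] by simp
  qed
  finally show ?thesis
    using index_eq_card[OF S] index_eq_card[OF T] by (simp add: card_cartesian_product)
qed

text \<open>An automorphism carries a transversal for \<open>m\<close> to one for
  \<open>f m\<close>. Applied to the Galois action this shows that conjugate elements have equal
  index.\<close>

lemma index_hom:
  assumes "bij_betw f R R"
    and "\<And>x y. x \<in> R \<Longrightarrow> y \<in> R \<Longrightarrow> f (x - y) = f x - f y"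
    and "\<And>x y. x \<in> R \<Longrightarrow> y \<in> R \<Longrightarrow> f (x * y) = f x * f y"
    and "m \<in> R"
  shows "index (f m) = index m"
proof -
  obtain T where T: "transversal m T"
    using ex_transversal by meson
  have TR: "T \<subseteq> R"
    using T by (auto simp: transversal_def)
  have fR: "f x \<in> R" if "x \<in> R" for x
    using assms(1) that by (auto simp: bij_betw_def)
  have eqmod_f: "eqmod (f m) (f x) (f y) \<longleftrightarrow> eqmod m x y" if "x \<in> R" "y \<in> R" for x y
  proof
    assume "eqmod m x y"
    then obtain u where "u \<in> R" "x - y = m * u"
      by (auto simp: eqmod_def)
    then have "f x - f y = f m * f u" "f u \<in> R"
      using assms that fR by metis+
    then show "eqmod (f m) (f x) (f y)"
      by (auto simp: eqmod_def)
  next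
    assume "eqmod (f m) (f x) (f y)"
    then obtain v where v: "v \<in> R" "f x - f y = f m * v"
      by (auto simp: eqmod_def)
    obtain u where u: "u \<in> R" "v = f u"
      using v assms(1) by (auto simp: bij_betw_def)
    have "f (x - y) = f (m * u)"
      using v u assms that by simp
    then have "x - y = m * u"
      using assms(1,4) that u diff_mem mult_mem by (auto simp: bij_betw_def inj_on_def)
    then show "eqmod m x y"
      using u by (auto simp: eqmod_def)
  qed
  have "transversal (f m) (f ` T)"
    unfolding transversal_def
  proof (intro conjI ballI impI)
    show "f ` T \<subseteq> R"
      using TR fR by auto
  next
    fix x
    assume "x \<in> R"
    then obtain y where y: "y \<in> R" "x = f y"
      using assms(1) by (auto simp: bij_betw_def)
    then obtain t where "t \<in> T" "eqmod m y t"
      using T by (auto simp: transversal_def)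
    then show "\<exists>t\<in>f ` T. eqmod (f m) x t"
      using eqmod_f[OF y(1), of t] TR y by auto
  next
    fix p q
    assume "p \<in> f ` T" "q \<in> f ` T" and pq: "eqmod (f m) p q"
    then obtain x y where xy: "x \<in> T" "y \<in> T" "p = f x" "q = f y"
      by auto
    then have "eqmod m x y"
      using eqmod_f[of x y] TR pq by auto
    then show "p = q"
      using T xy by (auto simp: transversal_def)
  qed
  then have "index (f m) = card (f ` T)"
    by (rule index_eq_card)
  also have "\<dots> = card T"
    using assms(1) TR by (meson bij_betw_def card_image inj_on_subset)
  finally show ?thesis
    using index_eq_card[OF T] by simp
qed

end

section \<open>The lattice of conjugate triples: size, independence, integral norms\<close>

context simplest_cubic
begin

text \<open>The difference is \<open>(r - s) * (y + z * (r + s))\<close>, and \<open>r + s\<close>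
  is the trace \<open>ra\<close> minus the third root. This is how \<open>w = y + a * z\<close>
  enters.\<close>

lemma ev_diff:
  assumes "r + s + t = ra"
  shows "ev r x y z - ev s x y z = (r - s) * (y + z * ra - z * t)"
  unfolding assms[symmetric] by (simp add: ev_def algebra_simps power2_eq_square)

lemma ev_diffs:
  shows "ev r1 x y z - ev r2 x y z = (r1 - r2) * (y + z * ra - z * r3)"
    and "ev r2 x y z - ev r3 x y z = (r2 - r3) * (y + z * ra - z * r1)"
    and "ev r1 x y z - ev r3 x y z = (r1 - r3) * (y + z * ra - z * r2)"
  using sum_roots by (auto intro!: ev_diff)

text \<open>The large gaps \<open>r1 - r2\<close> and \<open>r1 - r3\<close> bound
  \<open>w - z * r3\<close> and \<open>w - z * r2\<close> by \<open>2 * M / ra\<close>. Subtracting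
  these isolates \<open>z\<close>, because \<open>r3 - r2\<close> is at least 1; then
  \<open>w\<close> is bounded because \<open>r3\<close> is tiny.\<close>

lemma coord_bounds:
  assumes "\<bar>ev r1 x y z\<bar> \<le> M" "\<bar>ev r2 x y z\<bar> \<le> M" "\<bar>ev r3 x y z\<bar> \<le> M"
  shows "ra * \<bar>real_of_int z\<bar> \<le> 4 * M" "ra * \<bar>y + z * ra\<bar> \<le> 4 * M"
proof -
  let ?w = "y + z * ra"
  have gap: "ra * \<bar>v\<bar> \<le> 2 * M" if "d \<ge> ra" "\<bar>d * v\<bar> \<le> 2 * M" for d v
  proof -
    have "ra * \<bar>v\<bar> \<le> d * \<bar>v\<bar>"
      using that by (intro mult_right_mono) auto
    also have "\<dots> = \<bar>d * v\<bar>"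
      using that real_a_ge by (simp add: abs_mult)
    finally show ?thesis
      using that by simp
  qed
  have 1: "ra * \<bar>?w - z * r3\<bar> \<le> 2 * M"
    by (rule gap[of "r1 - r2"]) (use r1_gt r2_bounds in linarith, unfold ev_diffs[of x, symmetric], use assms in linarith)
  have 2: "ra * \<bar>?w - z * r2\<bar> \<le> 2 * M"
    by (rule gap[of "r1 - r3"]) (use r1_gt r3_bounds in linarith, unfold ev_diffs[of x, symmetric], use assms in linarith)
  have "r3 - r2 \<ge> 1"
  proof -
    have "1 / (1 + r1) \<le> 1 / r1"
      using r1_pos by (intro divide_left_mono) auto
    then show ?thesis
      by (simp add: r2_eq r3_eq)
  qed
  then have "\<bar>real_of_int z\<bar> * 1 \<le> \<bar>real_of_int z\<bar> * \<bar>r3 - r2\<bar>"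
    by (intro mult_left_mono) auto
  also have "\<dots> = \<bar>(?w - z * r2) - (?w - z * r3)\<bar>"
    by (simp add: algebra_simps flip: abs_mult)
  also have "\<dots> \<le> \<bar>?w - z * r2\<bar> + \<bar>?w - z * r3\<bar>"
    by (rule abs_triangle_ineq4)
  finally have "ra * \<bar>real_of_int z\<bar> \<le> ra * (\<bar>?w - z * r2\<bar> + \<bar>?w - z * r3\<bar>)"
    using real_a_ge by (intro mult_left_mono) auto
  then show z: "ra * \<bar>real_of_int z\<bar> \<le> 4 * M"
    using 1 2 by (simp add: distrib_left)
  have "\<bar>r3\<bar> \<le> 1 / ra"
    using r3_bounds by auto
  then have "\<bar>r3\<bar> \<le> 1 / 2"
    using real_a_ge by (smt (verit) frac_le)
  then have "\<bar>real_of_int z\<bar> * \<bar>r3\<bar> \<le> \<bar>real_of_int z\<bar> * (1 / 2)"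
    by (intro mult_left_mono) auto
  then have "\<bar>?w\<bar> \<le> \<bar>?w - z * r3\<bar> + \<bar>real_of_int z\<bar> / 2"
    by (simp flip: abs_mult)
  then have "ra * \<bar>?w\<bar> \<le> ra * (\<bar>?w - z * r3\<bar> + \<bar>real_of_int z\<bar> / 2)"
    using real_a_ge by (intro mult_left_mono) auto
  then show "ra * \<bar>?w\<bar> \<le> 4 * M"
    using 1 z by (simp add: distrib_left)
qed

text \<open>By \<open>coord_bounds\<close> the integers \<open>z\<close> and
  \<open>y + z * a\<close> are below 1 in absolute value, so they vanish and only the rational
  coordinate remains.\<close>

lemma conj3_small:
  assumes "conj3 A B C" "\<bar>A\<bar> < ra / 4" "\<bar>B\<bar> < ra / 4" "\<bar>C\<bar> < ra / 4"
  obtains n :: int where "A = n" "B = n" "C = n"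
proof -
  obtain x y z where xyz: "A = ev r1 x y z" "B = ev r2 x y z" "C = ev r3 x y z"
    using assms by (auto simp: conj3_def)
  define M where "M = Max {\<bar>A\<bar>, \<bar>B\<bar>, \<bar>C\<bar>}"
  have M: "\<bar>A\<bar> \<le> M" "\<bar>B\<bar> \<le> M" "\<bar>C\<bar> \<le> M" "4 * M < ra * 1"
    using assms by (auto simp: M_def max_def)
  have "ra * \<bar>real_of_int z\<bar> < ra * 1" "ra * \<bar>y + z * ra\<bar> < ra * 1"
    using coord_bounds[of x y z M] M unfolding xyz by linarith+
  then have "\<bar>real_of_int z\<bar> < 1" "\<bar>real_of_int (y + z * a)\<bar> < 1"
    using real_a_ge by (simp_all add: mult_less_cancel_left_pos)
  then have z: "z = 0" and "y + z * a = 0"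
    by linarith+
  then have "y = 0"
    by simp
  then show ?thesis
    using that xyz z by (simp add: ev_def)
qed

text \<open>Multiplication by powers of a unit with middle conjugate \<open>r3\<close> makes \<open>t\<close> arbitrarily small.\<close>

lemma conj3_zero_zero:
  assumes "conj3 0 t 0"
  shows "t = 0"
proof (rule ccontr)
  assume t: "t \<noteq> 0"
  have r3: "\<bar>r3\<bar> < 1"
    using r3_bounds real_a_ge by (smt (verit) divide_less_eq_1_pos minus_divide_left)
  have "ra / 4 / \<bar>t\<bar> > 0"
    using t real_a_ge by simp
  then obtain n where n: "\<bar>r3\<bar> ^ n < ra / 4 / \<bar>t\<bar>"
    using real_arch_pow_inv r3 by blast
  then have "\<bar>t * r3 ^ n\<bar> < ra / 4"
    using t by (simp add: abs_mult power_abs field_simps)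
  moreover have "conj3 0 (t * r3 ^ n) 0"
    using conj3_mult[OF assms conj3_power[OF conj3_rot[OF conj3_roots], of n]] by simp
  ultimately obtain k :: int where "0 = real_of_int k" "t * r3 ^ n = real_of_int k"
    using conj3_small[of 0 "t * r3 ^ n" 0] real_a_ge by auto
  then show False
    using t r3_bounds by simp
qed

text \<open>The product of \<open>(0, B, C)\<close> with its rotation \<open>(B, C, 0)\<close> is
  \<open>(0, B * C, 0)\<close>, so \<open>B\<close> or \<open>C\<close> vanishes; rotating puts the
  remaining entry in the middle. This takes the place of the irreducibility of the cubic.\<close>

lemma conj3_zero:
  assumes "conj3 0 B C"
  shows "B = 0 \<and> C = 0"
proof -
  have "conj3 0 (B * C) 0"
    using conj3_mult[OF assms conj3_rot[OF assms]] by simp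
  from conj3_zero_zero[OF this] have "B = 0 \<or> C = 0"
    by simp
  then show ?thesis
    using assms conj3_zero_zero conj3_rot by blast
qed

lemma conj3_zero_iff:
  assumes "conj3 A B C"
  shows "B = 0 \<longleftrightarrow> A = 0" "C = 0 \<longleftrightarrow> A = 0"
  using assms conj3_zero conj3_rot by metis+

lemma conj3_unique:
  assumes "conj3 A B C" "conj3 A B' C'"
  shows "B = B'" "C = C'"
  using conj3_zero[of "B - B'" "C - C'"] conj3_diff[OF assms] by auto

lemma ev_diffs_eq_0:
  assumes "ev r1 x y z = ev r2 x y z" "ev r1 x y z = ev r3 x y z"
  shows "y = 0" "z = 0"
proof -
  have "(r1 - r2) * (y + z * ra - z * r3) = 0" "(r1 - r3) * (y + z * ra - z * r2) = 0"
    unfolding ev_diffs[of x, symmetric] using assms by linarith+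
  moreover have "r1 - r2 \<noteq> 0" "r1 - r3 \<noteq> 0"
    using r1_pos r2_bounds r3_bounds by linarith+
  ultimately have y: "y + z * ra - z * r3 = 0" and "y + z * ra - z * r2 = 0"
    by (simp_all only: mult_eq_0_iff simp_thms)
  then have "real_of_int z * (r3 - r2) = 0"
    unfolding right_diff_distrib by linarith
  moreover have "r3 \<noteq> r2"
  proof -
    have "1 / ra \<le> 1"
      using real_a_ge by simp
    then show ?thesis
      using r2_bounds r3_bounds by linarith
  qed
  ultimately show z: "z = 0"
    by simp
  then show "y = 0"
    using y by simp
qed

text \<open>Linear independence of \<open>1\<close>, \<open>r1\<close>, \<open>r1^2\<close> over the
  integers: a zero passes to the other conjugates, and coinciding conjugates force \<open>y\<close>
  and \<open>z\<close> to vanish.\<close>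

lemma ev_r1_eq_0:
  assumes "ev r1 x y z = 0"
  shows "x = 0" "y = 0" "z = 0"
proof -
  have "ev r2 x y z = 0" "ev r3 x y z = 0"
    using conj3_zero[of "ev r2 x y z" "ev r3 x y z"] conj3_ev[of x y z] unfolding assms by blast+
  then show y: "y = 0" and z: "z = 0"
    using ev_diffs_eq_0[of x y z] assms by auto
  then show "x = 0"
    using assms by (simp add: ev_def)
qed

lemma ev_r1_inj:
  assumes "ev r1 x y z = ev r1 x' y' z'"
  shows "x = x'" "y = y'" "z = z'"
proof -
  have "ev r1 (x - x') (y - y') (z - z') = 0"
    using assms by (simp add: ev_def algebra_simps)
  from ev_r1_eq_0[OF this] show "x = x'" "y = y'" "z = z'"
    by simp_all
qed

lemma conj3_rational:
  assumes "conj3 A A A"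
  obtains n :: int where "A = n"
proof -
  obtain x y z where x1: "A = ev r1 x y z" and x2: "A = ev r2 x y z" and x3: "A = ev r3 x y z"
    using assms unfolding conj3_def by blast
  have "y = 0" "z = 0"
    by (rule ev_diffs_eq_0[of x y z]; metis x1 x2 x3)+
  then show ?thesis
    using that x1 by (simp add: ev_def)
qed

text \<open>The product \<open>A * B * C\<close> is invariant under rotation, so its three
  conjugates agree.\<close>

lemma norm_int:
  assumes "conj3 A B C"
  obtains n :: int where "A * B * C = n"
proof -
  have "conj3 (A * (B * C)) (B * (C * A)) (C * (A * B))"
    by (rule conj3_mult[OF assms conj3_mult[OF conj3_rot[OF assms] conj3_rot2[OF assms]]])
  then have "conj3 (A * B * C) (A * B * C) (A * B * C)"
    by (simp add: mult_ac)
  then show ?thesis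
    using conj3_rational that by metis
qed

end

section \<open>The ring of integers\<close>

context simplest_cubic
begin

definition Zr :: "real set" where
  "Zr = {A. \<exists>B C. conj3 A B C}"

lemma conj3_mem: "conj3 A B C \<Longrightarrow> A \<in> Zr \<and> B \<in> Zr \<and> C \<in> Zr"
  unfolding Zr_def mem_Collect_eq using conj3_rot by metis

lemma mem_Zr_iff: "A \<in> Zr \<longleftrightarrow> (\<exists>x y z. A = ev r1 x y z)"
  by (auto simp: Zr_def conj3_def)

lemma ev_r1_mem: "ev r1 x y z \<in> Zr"
  using conj3_mem[OF conj3_ev] by simp

lemma of_int_Zr: "of_int n \<in> Zr"
  using conj3_mem conj3_of_int by blast

sublocale O: subring_of_type Zr
proof
  show "1 \<in> Zr"
    using conj3_mem[OF conj3_1] by simp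
  show "x - y \<in> Zr" "x * y \<in> Zr" if "x \<in> Zr" "y \<in> Zr" for x y
    using that unfolding Zr_def mem_Collect_eq by (meson conj3_diff conj3_mult)+
qed

text \<open>A generator of the Galois group as a function; on \<open>Zr\<close> the description is
  unique by \<open>conj3_unique\<close>.\<close>

definition conj_map :: "real \<Rightarrow> real" where
  "conj_map A = (THE B. \<exists>C. conj3 A B C)"

lemma conj_map_eq: "conj3 A B C \<Longrightarrow> conj_map A = B"
  unfolding conj_map_def using conj3_unique by blast

lemma bij_conj_map: "bij_betw conj_map Zr Zr"
proof (rule bij_betw_imageI)
  show "inj_on conj_map Zr"
  proof (rule inj_onI)
    fix A A'
    assume "A \<in> Zr" "A' \<in> Zr" and eq: "conj_map A = conj_map A'"
    then obtain B C B' C' where c: "conj3 A B C" "conj3 A' B' C'"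
      by (auto simp: Zr_def)
    then have "B = B'"
      using eq conj_map_eq by auto
    then show "A = A'"
      using conj3_unique(2)[OF conj3_rot[OF c(1)]] conj3_rot[OF c(2)] by blast
  qed
  show "conj_map ` Zr = Zr"
  proof
    show "conj_map ` Zr \<subseteq> Zr"
    proof clarify
      fix A
      assume "A \<in> Zr"
      then obtain B C where c: "conj3 A B C"
        by (auto simp: Zr_def)
      show "conj_map A \<in> Zr"
        using conj3_mem[OF c] conj_map_eq[OF c] by simp
    qed
    show "Zr \<subseteq> conj_map ` Zr"
    proof
      fix A
      assume "A \<in> Zr"
      then obtain B C where c: "conj3 A B C"
        by (auto simp: Zr_def)
      show "A \<in> conj_map ` Zr"
        using conj3_mem[OF c] conj_map_eq[OF conj3_rot2[OF c]] by force
    qed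
  qed
qed

lemma index_conj:
  assumes "conj3 A B C"
  shows "O.index B = O.index A"
proof -
  have "O.index (conj_map A) = O.index A"
  proof (rule O.index_hom[OF bij_conj_map])
    fix x y
    assume "x \<in> Zr" "y \<in> Zr"
    then obtain x2 x3 y2 y3 where c: "conj3 x x2 x3" "conj3 y y2 y3"
      by (auto simp: Zr_def)
    show "conj_map (x - y) = conj_map x - conj_map y" "conj_map (x * y) = conj_map x * conj_map y"
      using conj_map_eq[OF conj3_diff[OF c]] conj_map_eq[OF conj3_mult[OF c]] conj_map_eq[OF c(1)] conj_map_eq[OF c(2)]
      by simp_all
  qed (use conj3_mem[OF assms] in blast)
  then show ?thesis
    using conj_map_eq[OF assms] by simp
qed

lemma of_int_dvd_ev:
  assumes "u \<in> Zr" "ev r1 x y z = of_int n * u"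
  shows "n dvd x" "n dvd y" "n dvd z"
proof -
  obtain x' y' z' where "u = ev r1 x' y' z'"
    using assms(1) by (auto simp: mem_Zr_iff)
  then have "ev r1 x y z = ev r1 (n * x') (n * y') (n * z')"
    using assms(2) by (simp add: ev_def algebra_simps)
  from ev_r1_inj[OF this] show "n dvd x" "n dvd y" "n dvd z"
    by simp_all
qed

text \<open>In the basis \<open>1\<close>, \<open>r1\<close>, \<open>r1^2\<close> congruence modulo
  \<open>n\<close> is coordinatewise, so a cube of residues of side \<open>\<bar>n\<bar>\<close> is
  a transversal.\<close>

lemma index_of_int:
  assumes "n \<noteq> 0"
  shows "real (O.index (of_int n)) = \<bar>of_int n\<bar> ^ 3"
proof -
  \<comment> \<open>For positive \<open>m\<close> the remainder \<open>k mod m\<close> lies in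
    \<open>{0..<m}\<close>, also when \<open>n\<close> is negative.\<close>
  define m where "m = \<bar>n\<bar>"
  have m: "m > 0" "\<And>k. m dvd k \<longleftrightarrow> n dvd k"
    using assms by (auto simp: m_def)
  let ?f = "\<lambda>(x, y, z). ev r1 x y z"
  let ?B = "{0..<m} \<times> {0..<m} \<times> {0..<m}"
  have small: "i = j" if "0 \<le> i" "i < m" "0 \<le> j" "j < m" "n dvd i - j" for i j
  proof -
    have "m dvd i - j"
      using that m(2) by blast
    then have "i mod m = j mod m"
      by (simp add: mod_eq_dvd_iff)
    then show ?thesis
      using that by simp
  qed
  have "O.transversal (of_int n) (?f ` ?B)"
    unfolding O.transversal_def
  proof (intro conjI ballI impI)
    show "?f ` ?B \<subseteq> Zr"
      using ev_r1_mem by auto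
  next
    fix A
    assume "A \<in> Zr"
    then obtain x y z where A: "A = ev r1 x y z"
      by (auto simp: mem_Zr_iff)
    have "n dvd k - k mod m" for k
      using m(2)[of "k - k mod m"] dvd_minus_mod[of m k] by simp
    then have "\<exists>j. k - k mod m = n * j" for k
      by (auto simp: dvd_def)
    then obtain d where d: "\<And>k. k - k mod m = n * d k"
      using choice[of "\<lambda>k j. k - k mod m = n * j"] by auto
    have "A - ev r1 (x mod m) (y mod m) (z mod m) = ev r1 (x - x mod m) (y - y mod m) (z - z mod m)"
      unfolding A by (simp add: ev_def algebra_simps)
    also have "\<dots> = of_int n * ev r1 (d x) (d y) (d z)"
      unfolding d by (simp add: ev_def algebra_simps)
    finally have "O.eqmod (of_int n) A (ev r1 (x mod m) (y mod m) (z mod m))"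
      unfolding O.eqmod_def using ev_r1_mem by blast
    moreover have "(x mod m, y mod m, z mod m) \<in> ?B"
      using m by simp
    ultimately show "\<exists>t\<in>?f ` ?B. O.eqmod (of_int n) A t"
      by (metis (mono_tags, lifting) case_prod_conv image_eqI)
  next
    fix p q
    assume "p \<in> ?f ` ?B" "q \<in> ?f ` ?B" "O.eqmod (of_int n) p q"
    then obtain x y z x' y' z' u where xyz: "p = ev r1 x y z" "q = ev r1 x' y' z'"
      "(x, y, z) \<in> ?B" "(x', y', z') \<in> ?B" and u: "u \<in> Zr" "p - q = of_int n * u"
      by (auto simp: O.eqmod_def)
    have "ev r1 (x - x') (y - y') (z - z') = of_int n * u"
      using u xyz by (simp add: ev_def algebra_simps)
    note dvd = of_int_dvd_ev[OF u(1) this]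
    have "x = x'" "y = y'" "z = z'"
      by (rule small, use xyz(3,4) dvd in simp_all)+
    then show "p = q"
      using xyz by simp
  qed
  then have "O.index (of_int n) = card (?f ` ?B)"
    by (rule O.index_eq_card)
  also have "\<dots> = card ?B"
  proof (rule card_image, rule inj_onI)
    fix p q
    assume eq: "?f p = ?f q"
    obtain x y z x' y' z' where pq: "p = (x, y, z)" "q = (x', y', z')"
      by (cases p; cases q) blast
    then have "ev r1 x y z = ev r1 x' y' z'"
      using eq by simp
    from ev_r1_inj[OF this] show "p = q"
      using pq by simp
  qed
  also have "\<dots> = nat m ^ 3"
    by (simp add: card_cartesian_product power3_eq_cube)
  finally show ?thesis
    using m by (simp add: m_def)
qed

text \<open>By multiplicativity and Galois invariance, the cube of the index of \<open>A\<close> is the index of its norm.\<close>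

lemma index_eq_norm:
  assumes c: "conj3 A B C" and "A \<noteq> 0"
  shows "real (O.index A) = \<bar>A * B * C\<bar>"
proof -
  obtain n :: int where n: "A * B * C = n"
    using norm_int[OF c] .
  have nz: "B \<noteq> 0" "C \<noteq> 0"
    using conj3_zero_iff[OF c] assms by auto
  then have "n \<noteq> 0"
    using n assms by auto
  have mem: "A \<in> Zr" "B \<in> Zr" "C \<in> Zr"
    using conj3_mem[OF c] by auto
  have "O.index (of_int n) = O.index A * O.index B * O.index C"
    unfolding n[symmetric] using nz assms(2) mem
    by (simp add: O.index_mult O.mult_mem)
  also have "\<dots> = O.index A ^ 3"
    using index_conj[OF c] index_conj[OF conj3_rot[OF c]] by (simp add: power3_eq_cube)
  finally have "real (O.index A) ^ 3 = \<bar>of_int n\<bar> ^ 3"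
    using index_of_int[OF \<open>n \<noteq> 0\<close>] by simp
  then show ?thesis
    unfolding n by (simp add: power_eq_iff_eq_base)
qed

section \<open>Identification with the order generated by the root\<close>

lemma generate_ring_real_simps:
  "\<one>\<^bsub>ring_of_type_algebra\<^esub> = (1::real)" "a_inv ring_of_type_algebra x = - (x::real)"
  "x \<oplus>\<^bsub>ring_of_type_algebra\<^esub> y = x + (y::real)" "x \<otimes>\<^bsub>ring_of_type_algebra\<^esub> y = x * (y::real)"
proof -
  interpret R: ring "ring_of_type_algebra :: real ring"
    by (rule ring_from_type_algebra)
  have "a_inv ring_of_type_algebra x = - x"
    by (rule R.minus_equality) (auto simp: ring_of_type_algebra_def)
  then show "\<one>\<^bsub>ring_of_type_algebra\<^esub> = (1::real)" "a_inv ring_of_type_algebra x = - x"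
    "x \<oplus>\<^bsub>ring_of_type_algebra\<^esub> y = x + y" "x \<otimes>\<^bsub>ring_of_type_algebra\<^esub> y = x * y"
    by (auto simp: ring_of_type_algebra_def)
qed

lemma Z_rho_eq: "Z_rho a = Zr"
proof -
  let ?G = "generate_ring (ring_of_type_algebra :: real ring) {rho a}"
  note simps = generate_ring_real_simps
  have G: "subring_of_type ?G"
  proof
    show "1 \<in> ?G"
      using generate_ring.one[of "ring_of_type_algebra :: real ring"] by (simp add: simps)
    fix x y
    assume xy: "x \<in> ?G" "y \<in> ?G"
    show "x - y \<in> ?G"
      using generate_ring.eng_add[OF xy(1) generate_ring.a_inv[OF xy(2)]] by (simp add: simps)
    show "x * y \<in> ?G"
      using generate_ring.eng_mult[OF xy] by (simp add: simps)
  qed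
  interpret G: subring_of_type ?G
    by (rule G)
  have nat: "of_nat n \<in> ?G" for n
    by (induction n) (auto intro: G.zero_mem G.add_mem G.one_mem)
  have int: "of_int n \<in> ?G" for n
    by (cases n rule: int_cases2) (auto intro: nat G.minus_mem)
  have r: "r1 \<in> ?G"
    by (auto simp: r1_eq intro: generate_ring.incl)
  have "Zr \<subseteq> ?G"
  proof
    fix A
    assume "A \<in> Zr"
    then show "A \<in> ?G"
      by (auto simp: mem_Zr_iff ev_def power2_eq_square intro!: G.add_mem G.mult_mem int r)
  qed
  moreover have "A \<in> Zr" if "A \<in> ?G" for A
    using that
  proof induction
    case one
    show ?case using O.one_mem by (simp add: simps)
  next
    case (incl h)
    then show ?case using conj3_mem[OF conj3_roots] by (simp add: r1_eq)
  qed (simp_all add: simps O.minus_mem O.add_mem O.mult_mem)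
  ultimately show ?thesis
    unfolding Z_rho_def by blast
qed

end

section \<open>Principal ideals and their generators in the monogenic case\<close>

locale monogenic_simplest_cubic = simplest_cubic +
  assumes monogenic: "a \<in> monogenic_params"
begin

lemma O_K_simps:
  "carrier (O_K a) = Zr" "x \<oplus>\<^bsub>O_K a\<^esub> y = x + y" "x \<otimes>\<^bsub>O_K a\<^esub> y = x * y"
  "\<one>\<^bsub>O_K a\<^esub> = 1" "\<zero>\<^bsub>O_K a\<^esub> = 0"
  using monogenic Z_rho_eq
  by (simp_all add: monogenic_params_def, simp_all add: O_K_def ring_of_type_algebra_def)

sublocale K: cring "O_K a"
proof (rule cringI)
  show "abelian_group (O_K a)"
  proof (rule abelian_groupI)
    fix x
    assume "x \<in> carrier (O_K a)"
    then show "\<exists>y\<in>carrier (O_K a). y \<oplus>\<^bsub>O_K a\<^esub> x = \<zero>\<^bsub>O_K a\<^esub>"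
      unfolding O_K_simps using O.minus_mem by (intro bexI[of _ "- x"]) auto
  qed (auto simp: O_K_simps O.add_mem O.zero_mem)
  show "comm_monoid (O_K a)"
    by (rule comm_monoidI) (auto simp: O_K_simps O.mult_mem O.one_mem)
qed (auto simp: O_K_simps algebra_simps)

definition pideal :: "real \<Rightarrow> real set" where
  "pideal A = {A * x | x. x \<in> Zr}"

lemma PIdl_eq: "PIdl\<^bsub>O_K a\<^esub> A = pideal A"
  by (auto simp: cgenideal_def O_K_simps pideal_def mult.commute)

lemma principalideal_iff: "principalideal I (O_K a) \<longleftrightarrow> (\<exists>A\<in>Zr. I = pideal A)"
proof
  assume "principalideal I (O_K a)"
  then obtain A where "A \<in> carrier (O_K a)" "I = Idl\<^bsub>O_K a\<^esub> {A}"
    using principalideal.generate by blast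
  then show "\<exists>A\<in>Zr. I = pideal A"
    using K.cgenideal_eq_genideal PIdl_eq O_K_simps by auto
next
  assume "\<exists>A\<in>Zr. I = pideal A"
  then show "principalideal I (O_K a)"
    using K.cgenideal_is_principalideal PIdl_eq O_K_simps by auto
qed

lemma self_mem_pideal: "A \<in> pideal A"
  unfolding pideal_def using O.one_mem by force

lemma pideal_subset_iff:
  assumes "A \<in> Zr"
  shows "pideal A \<subseteq> pideal B \<longleftrightarrow> (\<exists>u\<in>Zr. A = B * u)"
proof
  assume "pideal A \<subseteq> pideal B"
  then show "\<exists>u\<in>Zr. A = B * u"
    using self_mem_pideal[of A] unfolding pideal_def by blast
next
  assume "\<exists>u\<in>Zr. A = B * u"
  then show "pideal A \<subseteq> pideal B"
    by (auto simp: pideal_def mult.assoc intro: O.mult_mem)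
qed

definition primitive_elt :: "real \<Rightarrow> bool" where
  "primitive_elt A \<longleftrightarrow> (\<forall>n::int. n \<ge> 2 \<longrightarrow> \<not> (\<exists>u\<in>Zr. A = of_int n * u))"

lemma primitive_pideal_iff:
  assumes "A \<in> Zr"
  shows "primitive_ideal a (pideal A) \<longleftrightarrow> primitive_elt A"
proof -
  have "ideal (pideal A) (O_K a)"
    using K.cgenideal_ideal[of A] assms by (simp add: PIdl_eq O_K_simps)
  then show ?thesis
    by (simp add: primitive_ideal_def PIdl_eq primitive_elt_def pideal_subset_iff[OF assms])
qed

lemma ideal_norm_pideal: "ideal_norm a (pideal A) = O.index A"
proof -
  have "pideal A +>\<^bsub>O_K a\<^esub> x = O.coset A x" for x
  proof (rule Set.set_eqI, rule iffI)
    fix y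
    assume "y \<in> pideal A +>\<^bsub>O_K a\<^esub> x"
    then show "y \<in> O.coset A x"
      by (auto simp: a_r_coset_def' O_K_simps pideal_def O.coset_def O.eqmod_def)
  next
    fix y
    assume "y \<in> O.coset A x"
    then obtain u where "u \<in> Zr" "y - x = A * u"
      by (auto simp: O.coset_def O.eqmod_def)
    then have "y = A * u + x" "A * u \<in> pideal A"
      by (auto simp: pideal_def)
    then show "y \<in> pideal A +>\<^bsub>O_K a\<^esub> x"
      by (auto simp: a_r_coset_def' O_K_simps)
  qed
  then have "carrier (O_K a Quot pideal A) = O.coset A ` Zr"
    by (auto simp: FactRing_def A_RCOSETS_def' a_r_coset_def' O_K_simps)
  then show ?thesis
    by (simp add: ideal_norm_def O.index_def)
qed

text \<open>Generators are kept together with their conjugates, so that norm, size and the action of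
  units can be read off the triple.\<close>

definition gens :: "real \<Rightarrow> (real \<times> real \<times> real) set" where
  "gens L = {p. case p of (A, B, C) \<Rightarrow> conj3 A B C \<and> A \<noteq> 0 \<and> primitive_elt A \<and> abs (A * B * C) \<le> L}"

definition ideals :: "real \<Rightarrow> real set set" where
  "ideals L = {I. principalideal I (O_K a) \<and> primitive_ideal a I \<and> real (ideal_norm a I) \<le> L}"

lemma ideals_eq: "ideals L = (\<lambda>p. pideal (fst p)) ` gens L"
proof (rule Set.set_eqI, rule iffI)
  fix I
  assume I: "I \<in> ideals L"
  then obtain A where A: "A \<in> Zr" "I = pideal A"
    by (auto simp: ideals_def principalideal_iff)
  then have primitive_elt: "primitive_elt A" and n: "real (O.index A) \<le> L"
    using I by (auto simp: ideals_def primitive_pideal_iff ideal_norm_pideal)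
  \<comment> \<open>The zero ideal satisfies the norm bound by convention, but it is not primitive,
    since \<open>0 = 2 * 0\<close>.\<close>
  have nz: "A \<noteq> 0"
    using primitive_elt[unfolded primitive_elt_def, rule_format, of 2] O.zero_mem by auto
  obtain B C where c: "conj3 A B C"
    using A by (auto simp: Zr_def)
  then have "(A, B, C) \<in> gens L"
    using nz primitive_elt n by (simp add: gens_def index_eq_norm)
  then show "I \<in> (\<lambda>p. pideal (fst p)) ` gens L"
    using A by force
next
  fix I
  assume "I \<in> (\<lambda>p. pideal (fst p)) ` gens L"
  then obtain A B C where A: "I = pideal A" "conj3 A B C" "A \<noteq> 0" "primitive_elt A" "\<bar>A * B * C\<bar> \<le> L"
    by (auto simp: gens_def)
  moreover have "A \<in> Zr"
    using A conj3_mem by blast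
  ultimately show "I \<in> ideals L"
    by (auto simp: ideals_def principalideal_iff primitive_pideal_iff ideal_norm_pideal index_eq_norm)
qed

lemma primitive_principal_count_eq: "primitive_principal_count a L = card (ideals L)"
  by (simp add: primitive_principal_count_def ideals_def)

end

section \<open>Lower bound\<close>

lemma sum_inverse_squares_le:
  assumes "n \<ge> 1"
  shows "(\<Sum>d=2..n. 1 / real d ^ 2) \<le> 3 / 4"
proof -
  \<comment> \<open>The strengthened bound makes the induction telescope; it is an equality at
    \<open>n = 2\<close>.\<close>
  have "(\<Sum>d=2..n. 1 / real d ^ 2) \<le> 3 / 4 - 1 / n" if "n \<ge> 2"
    using that
  proof (induction n rule: dec_induct)
    case base
    show ?case by simp
  next
    case (step n)
    have "1 / real (Suc n) ^ 2 \<le> 1 / (real n * real (Suc n))"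
      using step by (intro divide_left_mono) (auto simp: power2_eq_square)
    also have "\<dots> = 1 / n - 1 / Suc n"
      using step by (simp add: field_simps)
    finally show ?case
      using step by simp
  qed
  moreover have "1 / real n > 0"
    using assms by simp
  ultimately show ?thesis
    using assms by (cases "n = 1") (simp, linarith)
qed

text \<open>A pair with gcd \<open>d \<ge> 2\<close> is \<open>d\<close> times a pair from a box of
  side \<open>n div d\<close>. These boxes together contain at most three quarters of
  \<open>n^2\<close> pairs.\<close>

lemma card_coprime_pairs_ge:
  "4 * card {(x, y). x \<in> {1..n} \<and> y \<in> {1..n} \<and> coprime x y} \<ge> n\<^sup>2"
proof (cases "n = 0")
  case False
  let ?C = "{(x, y). x \<in> {1..n} \<and> y \<in> {1..n} \<and> coprime x y}"
  let ?D = "\<lambda>d. (\<lambda>(x, y). (d * x, d * y)) ` ({1..n div d} \<times> {1..n div d})"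
  have "{1..n} \<times> {1..n} \<subseteq> ?C \<union> (\<Union>d\<in>{2..n}. ?D d)"
  proof
    fix p
    assume "p \<in> {1..n} \<times> {1..n}"
    then obtain x y where xy: "x \<in> {1..n}" "y \<in> {1..n}" and p: "p = (x, y)"
      by blast
    show "p \<in> ?C \<union> (\<Union>d\<in>{2..n}. ?D d)"
    proof (cases "coprime x y")
      case nc: False
      define d where "d = gcd x y"
      have "d \<noteq> 1" "d \<noteq> 0" "d \<le> x"
        using nc xy by (auto simp: d_def coprime_iff_gcd_eq_1 intro: gcd_le1_nat)
      then have d: "d \<in> {2..n}"
        using xy by auto
      have eq: "x = d * (x div d)" "y = d * (y div d)"
        by (simp_all add: d_def)
      have "x div d \<noteq> 0" "y div d \<noteq> 0"
        using eq xy by (metis atLeastAtMost_iff mult_0_right not_one_le_zero)+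
      then have "x div d \<in> {1..n div d}" "y div d \<in> {1..n div d}"
        using xy by (auto intro: div_le_mono)
      then have "(x, y) \<in> ?D d"
        using eq by (metis (mono_tags, lifting) SigmaI case_prod_conv image_eqI)
      then show ?thesis
        using d p by blast
    qed (use xy p in simp)
  qed
  moreover have finC: "finite ?C"
    by (rule finite_subset[of _ "{1..n} \<times> {1..n}"]) auto
  ultimately have "card ({1..n} \<times> {1..n}) \<le> card (?C \<union> (\<Union>d\<in>{2..n}. ?D d))"
    by (intro card_mono) auto
  also have "\<dots> \<le> card ?C + card (\<Union>d\<in>{2..n}. ?D d)"
    by (rule card_Un_le)
  also have "card (\<Union>d\<in>{2..n}. ?D d) \<le> (\<Sum>d=2..n. card (?D d))"
    by (rule card_UN_le) auto
  also have "\<dots> \<le> (\<Sum>d=2..n. (n div d)\<^sup>2)"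
  proof (rule sum_mono)
    fix d
    have "card (?D d) \<le> card ({1..n div d} \<times> {1..n div d})"
      by (rule card_image_le) auto
    then show "card (?D d) \<le> (n div d)\<^sup>2"
      by (simp add: card_cartesian_product power2_eq_square)
  qed
  finally have "n\<^sup>2 \<le> card ?C + (\<Sum>d=2..n. (n div d)\<^sup>2)"
    by (simp add: card_cartesian_product power2_eq_square)
  then have "real (n\<^sup>2) \<le> real (card ?C + (\<Sum>d=2..n. (n div d)\<^sup>2))"
    by (simp only: of_nat_le_iff)
  also have "\<dots> = card ?C + (\<Sum>d=2..n. real (n div d) ^ 2)"
    by simp
  also have "(\<Sum>d=2..n. real (n div d) ^ 2) \<le> (\<Sum>d=2..n. real n ^ 2 * (1 / real d ^ 2))"
  proof (rule sum_mono)
    fix d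
    have "real (n div d) \<le> real n / real d"
      by (rule of_nat_div_le_of_nat)
    then have "real (n div d) ^ 2 \<le> (real n / real d) ^ 2"
      by (intro power_mono) auto
    then show "real (n div d) ^ 2 \<le> real n ^ 2 * (1 / real d ^ 2)"
      by (simp add: power_divide)
  qed
  also have "\<dots> = real n ^ 2 * (\<Sum>d=2..n. 1 / real d ^ 2)"
    by (simp add: sum_distrib_left)
  also have "\<dots> \<le> real n ^ 2 * (3 / 4)"
    using False by (intro mult_left_mono sum_inverse_squares_le) auto
  finally have "real (n\<^sup>2) \<le> real (4 * card ?C)"
    by simp
  then show ?thesis
    by (simp only: of_nat_le_iff)
qed simp

text \<open>Makes \<open>t\<close> negligible against \<open>ra\<close>: for
  \<open>t \<le> 10\<close> the bound 1000 suffices, and otherwise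
  \<open>100 * t \<le> t ^ 3\<close>.\<close>

lemma hundred_times_le:
  fixes t b :: real
  assumes "1 \<le> t" "t ^ 3 \<le> b" "1000 \<le> b"
  shows "100 * t \<le> b"
proof (cases "t \<le> 10")
  case False
  then have "10 * 10 * t \<le> t * t * t"
    by (intro mult_mono) auto
  also have "\<dots> = t ^ 3"
    by (simp add: power3_eq_cube)
  finally show ?thesis
    using assms by linarith
qed (use assms in auto)

context monogenic_simplest_cubic
begin

context
  fixes n :: nat
  assumes n_small: "32 * real n \<le> ra"
begin

text \<open>In the first conjugate the term \<open>y * r1\<close> dominates. Since \<open>r2\<close>
  and \<open>r3\<close> are negative, the two terms of the other conjugates have the same sign and
  cannot cancel, which gives the lower bound 1.\<close>

lemma linear_bounds:
  assumes "x \<in> {1..n}" "y \<in> {1..n}"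
  shows "ra / 2 \<le> \<bar>ev r1 (- int x) (int y) 0\<bar>" "\<bar>ev r1 (- int x) (int y) 0\<bar> \<le> 2 * ra * n"
    "1 \<le> \<bar>ev r2 (- int x) (int y) 0\<bar>" "\<bar>ev r2 (- int x) (int y) 0\<bar> \<le> 3 * n"
    "1 \<le> \<bar>ev r3 (- int x) (int y) 0\<bar>" "\<bar>ev r3 (- int x) (int y) 0\<bar> \<le> 2 * n"
proof -
  have xy: "1 \<le> real x" "real x \<le> n" "1 \<le> real y" "real y \<le> n"
    using assms by auto
  have "1 * ra \<le> y * r1" "y * r1 \<le> n * (2 * ra)"
    using xy r1_gt r1_lt real_a_ge by (intro mult_mono; simp)+
  moreover have "ev r1 (- int x) (int y) 0 = y * r1 - x"
    by (simp add: ev_def)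
  ultimately show "ra / 2 \<le> \<bar>ev r1 (- int x) (int y) 0\<bar>"
    "\<bar>ev r1 (- int x) (int y) 0\<bar> \<le> 2 * ra * n"
    using xy n_small real_a_ge by (auto simp: algebra_simps)
  have "0 \<le> y * (- r2)" "y * (- r2) \<le> n * 2"
    using xy r2_bounds by (auto intro!: mult_mono mult_nonneg_nonneg simp del: mult_minus_right)
  moreover have "ev r2 (- int x) (int y) 0 = - (y * (- r2) + x)"
    by (simp add: ev_def)
  ultimately show "1 \<le> \<bar>ev r2 (- int x) (int y) 0\<bar>" "\<bar>ev r2 (- int x) (int y) 0\<bar> \<le> 3 * n"
    using xy by auto
  have "1 / ra \<le> 1"
    using real_a_ge by simp
  then have "- r3 \<le> 1" "0 \<le> - r3"
    using r3_bounds by auto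
  then have "0 \<le> y * (- r3)" "y * (- r3) \<le> real n * 1"
    using xy by (intro mult_nonneg_nonneg mult_mono; simp)+
  moreover have "ev r3 (- int x) (int y) 0 = - (y * (- r3) + x)"
    by (simp add: ev_def)
  ultimately show "1 \<le> \<bar>ev r3 (- int x) (int y) 0\<bar>" "\<bar>ev r3 (- int x) (int y) 0\<bar> \<le> 2 * n"
    using xy by auto
qed

text \<open>Dividing the upper bounds of \<open>linear_bounds\<close> by the lower ones bounds the
  conjugates of \<open>u\<close> by \<open>4 * n\<close>, \<open>3 * n\<close> and
  \<open>2 * n\<close>.\<close>

lemma linear_quotient:
  assumes "x \<in> {1..n}" "y \<in> {1..n}" "x' \<in> {1..n}" "y' \<in> {1..n}"
    and u: "u \<in> Zr" "ev r1 (- int x) (int y) 0 = ev r1 (- int x') (int y') 0 * u"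
  obtains k :: int where "u = k"
proof -
  obtain u2 u3 where c: "conj3 u u2 u3"
    using u by (auto simp: Zr_def)
  note l = linear_bounds[OF assms(1,2)] and l' = linear_bounds[OF assms(3,4)]
  have "conj3 (ev r1 (- int x) (int y) 0) (ev r2 (- int x') (int y') 0 * u2)
      (ev r3 (- int x') (int y') 0 * u3)"
    unfolding u(2) by (rule conj3_mult[OF conj3_ev c])
  note eq = conj3_unique[OF conj3_ev this]
  have "(ra / 2) * \<bar>u\<bar> \<le> \<bar>ev r1 (- int x') (int y') 0\<bar> * \<bar>u\<bar>"
    using l' by (intro mult_right_mono) auto
  also have "\<dots> \<le> 2 * ra * n"
    using l u by (simp add: abs_mult)
  finally have "ra * \<bar>u\<bar> \<le> ra * (4 * n)"
    by simp
  then have 1: "\<bar>u\<bar> \<le> 4 * n"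
    using real_a_ge by (simp only: mult_le_cancel_left_pos)
  have "1 * \<bar>u2\<bar> \<le> \<bar>ev r2 (- int x') (int y') 0\<bar> * \<bar>u2\<bar>"
    using l' by (intro mult_right_mono) auto
  then have 2: "\<bar>u2\<bar> \<le> 3 * n"
    using l eq by (simp add: abs_mult)
  have "1 * \<bar>u3\<bar> \<le> \<bar>ev r3 (- int x') (int y') 0\<bar> * \<bar>u3\<bar>"
    using l' by (intro mult_right_mono) auto
  then have 3: "\<bar>u3\<bar> \<le> 2 * n"
    using l eq by (simp add: abs_mult)
  have "real n > 0"
    using assms by auto
  \<comment> \<open>Here \<open>n_small\<close> puts all conjugates of the quotient below the
    threshold of \<open>conj3_small\<close>.\<close>
  then have "4 * real n < ra / 4"
    using n_small by linarith
  then have "\<bar>u\<bar> < ra / 4" "\<bar>u2\<bar> < ra / 4" "\<bar>u3\<bar> < ra / 4"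
    using 1 2 3 by linarith+
  then obtain k :: int where "u = k"
    by (rule conj3_small[OF c])
  then show ?thesis
    using that by blast
qed

text \<open>If two of the ideals agree, the generators divide each other with integer quotients, so
  these are \<open>1\<close> or \<open>-1\<close>; positivity of the coordinates excludes
  \<open>-1\<close>.\<close>

lemma linear_pideal_inj:
  "inj_on (\<lambda>(x, y). pideal (ev r1 (- int x) (int y) 0)) ({1..n} \<times> {1..n})"
proof (rule inj_onI)
  fix p q
  assume "p \<in> {1..n} \<times> {1..n}" "q \<in> {1..n} \<times> {1..n}"
    and "(\<lambda>(x, y). pideal (ev r1 (- int x) (int y) 0)) p
       = (\<lambda>(x, y). pideal (ev r1 (- int x) (int y) 0)) q"
  then obtain x y x' y' where pq: "p = (x, y)" "q = (x', y')"
    and xy: "x \<in> {1..n}" "y \<in> {1..n}" and xy': "x' \<in> {1..n}" "y' \<in> {1..n}"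
    and eq: "pideal (ev r1 (- int x) (int y) 0) = pideal (ev r1 (- int x') (int y') 0)"
    by blast
  let ?A = "ev r1 (- int x) (int y) 0" and ?A' = "ev r1 (- int x') (int y') 0"
  obtain u where u: "u \<in> Zr" "?A = ?A' * u"
    using eq pideal_subset_iff[OF ev_r1_mem] by blast
  obtain v where v: "v \<in> Zr" "?A' = ?A * v"
    using eq pideal_subset_iff[OF ev_r1_mem] by blast
  obtain k l :: int where kl: "u = k" "v = l"
    using linear_quotient[OF xy xy' u] linear_quotient[OF xy' xy v] by metis
  have "?A \<noteq> 0"
    using linear_bounds[OF xy] real_a_ge by auto
  moreover have "?A * (of_int l * of_int k) = ?A * 1"
    using u v kl by (metis mult.assoc mult.right_neutral)
  ultimately have "real_of_int (l * k) = 1"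
    by (simp only: mult_cancel_left) simp
  then have "l * k = 1"
    by linarith
  then have "\<bar>k\<bar> = 1"
    by (metis abs_mult abs_one abs_zmult_eq_1 mult.commute)
  moreover have "?A = ev r1 (- int x' * k) (int y' * k) 0"
    using u kl by (simp add: ev_def algebra_simps)
  note ev_r1_inj[OF this]
  ultimately show "p = q"
    using xy xy' pq by (auto simp: abs_if split: if_splits)
qed

lemma linear_primitive:
  assumes "coprime x y"
  shows "primitive_elt (ev r1 (- int x) (int y) 0)"
  unfolding primitive_elt_def
proof (intro allI impI notI)
  fix k :: int
  assume "2 \<le> k" and "\<exists>u\<in>Zr. ev r1 (- int x) (int y) 0 = k * u"
  then obtain u :: real where u: "u \<in> Zr" "ev r1 (- int x) (int y) 0 = k * u"
    by blast
  have "k dvd int x" "k dvd int y"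
    using of_int_dvd_ev[OF u] by simp_all
  then have "k dvd 1"
    using assms coprime_common_divisor_int[of "int x" "int y" k] by (simp add: coprime_int_iff)
  then show False
    using \<open>2 \<le> k\<close> by (simp add: zdvd_not_zless)
qed

lemma card_ideals_ge:
  assumes "finite (ideals L)" and "12 * ra * n ^ 3 \<le> L"
  shows "n\<^sup>2 \<le> 4 * card (ideals L)"
proof -
  let ?C = "{(x, y). x \<in> {1..n} \<and> y \<in> {1..n} \<and> coprime x y}"
  let ?f = "\<lambda>(x, y). pideal (ev r1 (- int x) (int y) 0)"
  have "?f ` ?C \<subseteq> ideals L"
  proof clarify
    fix x y
    assume xy: "x \<in> {1..n}" "y \<in> {1..n}" and "coprime x y"
    let ?A = "ev r1 (- int x) (int y) 0" and ?B = "ev r2 (- int x) (int y) 0"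
      and ?C = "ev r3 (- int x) (int y) 0"
    note l = linear_bounds[OF xy]
    \<comment> \<open>The three upper bounds of \<open>linear_bounds\<close> multiply to
      \<open>12 * ra * n ^ 3\<close>.\<close>
    have "\<bar>?A * ?B * ?C\<bar> \<le> (2 * ra * n) * (3 * n) * (2 * n)"
      unfolding abs_mult using l real_a_ge by (intro mult_mono) auto
    also have "\<dots> \<le> L"
      using assms(2) by (simp add: power3_eq_cube)
    finally have "(?A, ?B, ?C) \<in> gens L"
      using linear_primitive[OF \<open>coprime x y\<close>] l real_a_ge by (auto simp: gens_def)
    then show "pideal ?A \<in> ideals L"
      unfolding ideals_eq by force
  qed
  then have "card (?f ` ?C) \<le> card (ideals L)"
    using assms(1) by (rule card_mono[rotated])
  moreover have "card (?f ` ?C) = card ?C"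
    by (rule card_image, rule inj_on_subset[OF linear_pideal_inj]) auto
  ultimately show ?thesis
    using card_coprime_pairs_ge[of n] by linarith
qed

end

lemma primitive_elt_1: "primitive_elt 1"
  unfolding primitive_elt_def
proof (intro allI impI notI)
  fix k :: int
  assume "2 \<le> k" and "\<exists>u\<in>Zr. 1 = k * u"
  then obtain u :: real where u: "u \<in> Zr" "1 = k * u"
    by blast
  have "ev r1 1 0 0 = k * u"
    using u by (simp add: ev_def)
  then have "k dvd 1"
    by (rule of_int_dvd_ev[OF u(1)])
  then show False
    using \<open>2 \<le> k\<close> by (simp add: zdvd_not_zless)
qed

lemma lower_bound:
  assumes "finite (ideals (ra * t ^ 3))" "1 \<le> t" "t ^ 3 \<le> ra"
  shows "t\<^sup>2 \<le> 144 * card (ideals (ra * t ^ 3))"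
proof (cases "t < 3")
  case True
  \<comment> \<open>For \<open>t < 3\<close> the linear family is empty, and the unit ideal alone
    suffices because \<open>t^2 \<le> 9\<close>.\<close>
  have "1 * 1 \<le> ra * t ^ 3"
    using assms real_a_ge by (intro mult_mono) auto
  then have "(1, 1, 1) \<in> gens (ra * t ^ 3)"
    using primitive_elt_1 by (auto simp: gens_def)
  then have "ideals (ra * t ^ 3) \<noteq> {}"
    unfolding ideals_eq by blast
  then have "card (ideals (ra * t ^ 3)) \<ge> 1"
    using assms(1) by (simp add: Suc_leI card_gt_0_iff)
  then have "1 \<le> real (card (ideals (ra * t ^ 3)))"
    by simp
  moreover have "t\<^sup>2 \<le> 3\<^sup>2"
    using True assms by (intro power_mono) auto
  ultimately show ?thesis
    by simp
next
  case False
  \<comment> \<open>The factor \<open>1 / 3\<close> keeps the norms in range, since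
    \<open>12 / 27 \<le> 1\<close>.\<close>
  define n where "n = nat \<lfloor>t / 3\<rfloor>"
  have n: "real n \<le> t / 3" "t / 3 < real n + 1"
  proof -
    have "real n = of_int \<lfloor>t / 3\<rfloor>"
      using False by (simp add: n_def)
    then show "real n \<le> t / 3" "t / 3 < real n + 1"
      by linarith+
  qed
  then have "n \<noteq> 0"
    using False by (intro notI) simp
  then have "real n \<ge> 1"
    by simp
  \<comment> \<open>From \<open>t < 3 * n + 3\<close> and \<open>n \<ge> 1\<close>; this loss
    produces the constant \<open>144 = 4 * 6^2\<close>.\<close>
  then have t: "t \<le> 6 * real n"
    using n by linarith
  have "12 * ra * n ^ 3 \<le> 12 * ra * (t / 3) ^ 3"
    using n real_a_ge by (intro mult_left_mono power_mono) auto
  also have "\<dots> \<le> ra * t ^ 3"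
    using assms real_a_ge by (simp add: power_divide)
  finally have "n\<^sup>2 \<le> 4 * card (ideals (ra * t ^ 3))"
    using assms hundred_times_le[OF assms(2,3) real_a_ge] n by (intro card_ideals_ge) auto
  then have "real (n\<^sup>2) \<le> real (4 * card (ideals (ra * t ^ 3)))"
    by (simp only: of_nat_le_iff)
  moreover have "t\<^sup>2 \<le> (6 * real n)\<^sup>2"
    using t assms by (intro power_mono) auto
  ultimately show ?thesis
    by (simp add: power_mult_distrib)
qed

end

section \<open>Counting integers near roots\<close>

lemma finite_int_near:
  fixes b R :: real
  shows "finite {x :: int. \<bar>of_int x + b\<bar> \<le> R}"
proof (rule finite_subset)
  show "{x :: int. \<bar>of_int x + b\<bar> \<le> R} \<subseteq> {\<lceil>- R - b\<rceil>..\<lfloor>R - b\<rfloor>}"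
    by (auto simp: ceiling_le_iff le_floor_iff)
qed simp

lemma card_int_near:
  fixes b R :: real
  assumes "0 \<le> R"
  shows "card {x :: int. \<bar>of_int x + b\<bar> \<le> R} \<le> 2 * R + 1"
proof -
  have "{x :: int. \<bar>of_int x + b\<bar> \<le> R} = {\<lceil>- R - b\<rceil>..\<lfloor>R - b\<rfloor>}"
    by (auto simp: ceiling_le_iff le_floor_iff)
  then have "card {x :: int. \<bar>of_int x + b\<bar> \<le> R} = nat (\<lfloor>R - b\<rfloor> - \<lceil>- R - b\<rceil> + 1)"
    by simp
  also have "real \<dots> \<le> max 0 (of_int \<lfloor>R - b\<rfloor> - of_int \<lceil>- R - b\<rceil> + 1)"
    by (cases "\<lfloor>R - b\<rfloor> - \<lceil>- R - b\<rceil> + 1 \<ge> 0") auto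
  also have "\<dots> \<le> 2 * R + 1"
    using assms of_int_floor_le[of "R - b"] le_of_int_ceiling[of "- R - b"] by linarith
  finally show ?thesis .
qed

text \<open>If two factors are at least \<open>D / 2\<close>, the third is at most
  \<open>4 * L / D^2\<close>; \<open>R\<close> stands for any bound of this quotient.\<close>

lemma factor_le:
  fixes p q s D L R :: real
  assumes "p * q * s \<le> L" "D / 2 \<le> q" "D / 2 \<le> s" "0 < D" "0 \<le> p" "4 * L \<le> R * D\<^sup>2"
  shows "p \<le> R"
proof -
  have "p * (D / 2) * (D / 2) \<le> p * q * s"
    using assms by (intro mult_mono) auto
  then have "p * D\<^sup>2 \<le> 4 * (p * q * s)"
    by (simp add: power2_eq_square)
  then have "p * D\<^sup>2 \<le> R * D\<^sup>2"
    using assms by linarith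
  then show ?thesis
    using assms by simp
qed

text \<open>The integers where a monic cubic with roots \<open>- b1\<close>, \<open>- b2\<close>,
  \<open>- b3\<close> is small. With the conjugates of \<open>y * \<rho> + z * \<rho>^2\<close> as
  shifts it becomes the norm condition on the rational coordinate.\<close>

definition cubic_small :: "real \<Rightarrow> real \<Rightarrow> real \<Rightarrow> real \<Rightarrow> int set" where
  "cubic_small b1 b2 b3 L = {x. \<bar>of_int x + b1\<bar> * \<bar>of_int x + b2\<bar> * \<bar>of_int x + b3\<bar> \<le> L}"

lemma cubic_small_commute:
  "cubic_small b1 b2 b3 L = cubic_small b2 b1 b3 L"
  "cubic_small b1 b2 b3 L = cubic_small b1 b3 b2 L"
  by (auto simp: cubic_small_def mult_ac)

lemma card_three_near:
  fixes b1 b2 b3 R1 R2 R3 :: real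
  assumes "S \<subseteq> {x :: int. \<bar>of_int x + b1\<bar> \<le> R1} \<union> {x. \<bar>of_int x + b2\<bar> \<le> R2}
      \<union> {x. \<bar>of_int x + b3\<bar> \<le> R3}"
    and "0 \<le> R1" "0 \<le> R2" "0 \<le> R3"
  shows "finite S \<and> card S \<le> 2 * (R1 + R2 + R3) + 3"
proof
  let ?A = "{x :: int. \<bar>of_int x + b1\<bar> \<le> R1}" and ?B = "{x :: int. \<bar>of_int x + b2\<bar> \<le> R2}"
    and ?C = "{x :: int. \<bar>of_int x + b3\<bar> \<le> R3}"
  have fin: "finite (?A \<union> ?B \<union> ?C)"
    using finite_int_near by simp
  then show "finite S"
    using assms(1) finite_subset by blast
  have "card S \<le> card (?A \<union> ?B \<union> ?C)"
    using fin assms(1) by (rule card_mono)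
  also have "\<dots> \<le> card ?A + card ?B + card ?C"
    using card_Un_le[of "?A \<union> ?B" ?C] card_Un_le[of ?A ?B] by linarith
  finally have "real (card S) \<le> real (card ?A) + real (card ?B) + real (card ?C)"
    by (simp flip: of_nat_add)
  also have "\<dots> \<le> (2 * R1 + 1) + (2 * R2 + 1) + (2 * R3 + 1)"
    using assms by (intro add_mono card_int_near)
  also have "\<dots> = 2 * (R1 + R2 + R3) + 3"
    by simp
  finally show "card S \<le> 2 * (R1 + R2 + R3) + 3" .
qed

text \<open>At most one root can lie closer than \<open>D / 2\<close> to \<open>x\<close>, so two
  factors are large and \<open>x\<close> is within \<open>R\<close> of the remaining root.\<close>

lemma card_cubic_small_separated:
  fixes D R :: real
  assumes "D \<le> \<bar>b1 - b2\<bar>" "D \<le> \<bar>b1 - b3\<bar>" "D \<le> \<bar>b2 - b3\<bar>" "0 < D"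
    and "4 * L \<le> R * D\<^sup>2" "0 \<le> R"
  shows "finite (cubic_small b1 b2 b3 L) \<and> card (cubic_small b1 b2 b3 L) \<le> 6 * R + 3"
proof -
  have "cubic_small b1 b2 b3 L \<subseteq> {x. \<bar>of_int x + b1\<bar> \<le> R} \<union> {x. \<bar>of_int x + b2\<bar> \<le> R}
      \<union> {x. \<bar>of_int x + b3\<bar> \<le> R}"
  proof
    fix x
    assume "x \<in> cubic_small b1 b2 b3 L"
    then have p: "\<bar>of_int x + b1\<bar> * \<bar>of_int x + b2\<bar> * \<bar>of_int x + b3\<bar> \<le> L"
      by (simp add: cubic_small_def)
    consider "D / 2 \<le> \<bar>of_int x + b2\<bar>" "D / 2 \<le> \<bar>of_int x + b3\<bar>"
      | "D / 2 \<le> \<bar>of_int x + b1\<bar>" "D / 2 \<le> \<bar>of_int x + b3\<bar>"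
      | "D / 2 \<le> \<bar>of_int x + b1\<bar>" "D / 2 \<le> \<bar>of_int x + b2\<bar>"
      using assms(1-3) by linarith
    then show "x \<in> {x. \<bar>of_int x + b1\<bar> \<le> R} \<union> {x. \<bar>of_int x + b2\<bar> \<le> R}
      \<union> {x. \<bar>of_int x + b3\<bar> \<le> R}"
    proof cases
      case 1
      then show ?thesis
        using factor_le[OF p 1 assms(4) _ assms(5)] by simp
    next
      case 2
      have "\<bar>of_int x + b2\<bar> * \<bar>of_int x + b1\<bar> * \<bar>of_int x + b3\<bar> \<le> L"
        using p by (simp add: mult_ac)
      then show ?thesis
        using factor_le[OF _ 2 assms(4) _ assms(5)] by simp
    next
      case 3
      have "\<bar>of_int x + b3\<bar> * \<bar>of_int x + b1\<bar> * \<bar>of_int x + b2\<bar> \<le> L"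
        using p by (simp add: mult_ac)
      then show ?thesis
        using factor_le[OF _ 3 assms(4) _ assms(5)] by simp
    qed
  qed
  from card_three_near[OF this] show ?thesis
    using assms by simp
qed

text \<open>The first two roots may be close or equal. If \<open>x\<close> is far from the third,
  the product of the first two factors is at most \<open>2 * L / D\<close>, so one of them is at
  most \<open>Q\<close>. Otherwise both are large and the third is at most \<open>R\<close>.\<close>

lemma card_cubic_small_far:
  fixes D R Q :: real
  assumes "D \<le> \<bar>b1 - b3\<bar>" "D \<le> \<bar>b2 - b3\<bar>" "0 < D"
    and "4 * L \<le> R * D\<^sup>2" "0 \<le> R" "2 * L \<le> Q\<^sup>2 * D" "0 \<le> Q"
  shows "finite (cubic_small b1 b2 b3 L) \<and> card (cubic_small b1 b2 b3 L) \<le> 2 * R + 4 * Q + 3"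
proof -
  have "cubic_small b1 b2 b3 L \<subseteq> {x. \<bar>of_int x + b1\<bar> \<le> Q} \<union> {x. \<bar>of_int x + b2\<bar> \<le> Q}
      \<union> {x. \<bar>of_int x + b3\<bar> \<le> R}"
  proof
    fix x
    assume "x \<in> cubic_small b1 b2 b3 L"
    then have p: "\<bar>of_int x + b1\<bar> * \<bar>of_int x + b2\<bar> * \<bar>of_int x + b3\<bar> \<le> L"
      by (simp add: cubic_small_def)
    show "x \<in> {x. \<bar>of_int x + b1\<bar> \<le> Q} \<union> {x. \<bar>of_int x + b2\<bar> \<le> Q}
      \<union> {x. \<bar>of_int x + b3\<bar> \<le> R}"
    proof (cases "D / 2 \<le> \<bar>of_int x + b3\<bar>")
      case False
      then have far: "D / 2 \<le> \<bar>of_int x + b1\<bar>" "D / 2 \<le> \<bar>of_int x + b2\<bar>"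
        using assms(1,2) by linarith+
      have "\<bar>of_int x + b3\<bar> * \<bar>of_int x + b1\<bar> * \<bar>of_int x + b2\<bar> \<le> L"
        using p by (simp add: mult_ac)
      then show ?thesis
        using factor_le[OF _ far assms(3) _ assms(4)] by simp
    next
      case True
      have False if "Q < \<bar>of_int x + b1\<bar>" "Q < \<bar>of_int x + b2\<bar>"
      proof -
        have "Q * Q < \<bar>of_int x + b1\<bar> * \<bar>of_int x + b2\<bar>"
          using that assms(7) by (intro mult_strict_mono) auto
        then have "Q * Q * (D / 2) < \<bar>of_int x + b1\<bar> * \<bar>of_int x + b2\<bar> * (D / 2)"
          using assms(3) by (intro mult_strict_right_mono) auto
        also have "\<dots> \<le> \<bar>of_int x + b1\<bar> * \<bar>of_int x + b2\<bar> * \<bar>of_int x + b3\<bar>"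
          using True by (intro mult_left_mono) auto
        finally show False
          using p assms(6) by (simp add: power2_eq_square)
      qed
      then show ?thesis
        by fastforce
    qed
  qed
  from card_three_near[OF this] show ?thesis
    using assms by simp
qed

lemma sum_inverse_sqrt_le: "(\<Sum>k=1..n. 1 / sqrt (real k)) \<le> 2 * sqrt (real n)"
proof (induction n)
  case (Suc n)
  have "1 / sqrt (real (Suc n)) \<le> 2 * (sqrt (real (Suc n)) - sqrt (real n))"
  proof -
    have s: "sqrt (real (Suc n)) ^ 2 = real n + 1" "sqrt (real n) ^ 2 = real n"
      by simp_all
    \<comment> \<open>Expanding this square gives
      \<open>2 * sqrt n * sqrt (n + 1) \<le> 2 * n + 1\<close>.\<close>
    have "0 \<le> (sqrt (real (Suc n)) - sqrt (real n))\<^sup>2"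
      by simp
    then have "1 \<le> 2 * (sqrt (real (Suc n)) - sqrt (real n)) * sqrt (real (Suc n))"
      using s by (simp add: power2_eq_square algebra_simps)
    then show ?thesis
      by (simp add: pos_divide_le_eq)
  qed
  then show ?case
    using Suc by (simp add: algebra_simps)
qed simp

text \<open>The abstract \<open>F\<close> treats all three degenerate lines at once. Summing over
  both signs of \<open>k\<close> gives at most \<open>1120 * t + 128 * t^2\<close>, and
  \<open>t \<le> t^2\<close>.\<close>

lemma card_degenerate_le:
  fixes t :: real
  assumes "1 \<le> t"
    and F: "\<And>k :: int. k \<noteq> 0 \<Longrightarrow> \<bar>real_of_int k\<bar> \<le> 16 * t \<Longrightarrow>
      finite (F k) \<and> card (F k) \<le> 35 + 8 * sqrt (t ^ 3 / \<bar>real_of_int k\<bar>)"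
  defines "I \<equiv> {k :: int. k \<noteq> 0 \<and> \<bar>real_of_int k\<bar> \<le> 16 * t}"
  shows "finite (SIGMA k:I. F k) \<and> card (SIGMA k:I. F k) \<le> 1248 * t\<^sup>2"
proof
  define m where "m = nat \<lfloor>16 * t\<rfloor>"
  have m: "real m \<le> 16 * t"
    unfolding m_def using assms(1) by (simp add: of_nat_nat)
  have I_eq: "I = int ` {1..m} \<union> (\<lambda>k. - int k) ` {1..m}"
  proof (rule Set.set_eqI, rule iffI)
    fix k
    assume "k \<in> I"
    then have k: "k \<noteq> 0" "\<bar>k\<bar> \<le> \<lfloor>16 * t\<rfloor>"
      by (auto simp: I_def le_floor_iff)
    then have "nat \<bar>k\<bar> \<in> {1..m}"
      by (auto simp: m_def)
    moreover have "k = int (nat \<bar>k\<bar>) \<or> k = - int (nat \<bar>k\<bar>)"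
      by auto
    ultimately show "k \<in> int ` {1..m} \<union> (\<lambda>k. - int k) ` {1..m}"
      by blast
  next
    fix k
    assume "k \<in> int ` {1..m} \<union> (\<lambda>k. - int k) ` {1..m}"
    then show "k \<in> I"
      using m by (auto simp: I_def)
  qed
  have finI: "finite I"
    unfolding I_eq by simp
  then show "finite (SIGMA k:I. F k)"
    using F by (auto simp: I_def)
  let ?g = "\<lambda>k. 35 + 8 * sqrt (t ^ 3 / \<bar>real_of_int k\<bar>)"
  have "real (card (SIGMA k:I. F k)) = (\<Sum>k\<in>I. real (card (F k)))"
    using finI F by (subst card_SigmaI) (auto simp: I_def)
  also have "\<dots> \<le> (\<Sum>k\<in>I. ?g k)"
    using F by (intro sum_mono) (auto simp: I_def)
  also have "\<dots> = (\<Sum>k\<in>int ` {1..m}. ?g k) + (\<Sum>k\<in>(\<lambda>k. - int k) ` {1..m}. ?g k)"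
    unfolding I_eq by (rule sum.union_disjoint) auto
  also have "\<dots> = 2 * (\<Sum>k=1..m. 35 + 8 * sqrt (t ^ 3 / real k))"
    by (subst (1 2) sum.reindex) (auto simp: inj_on_def)
  also have "(\<Sum>k=1..m. 35 + 8 * sqrt (t ^ 3 / real k)) =
      35 * real m + 8 * sqrt (t ^ 3) * (\<Sum>k=1..m. 1 / sqrt (real k))"
    by (simp add: sum.distrib sum_distrib_left real_sqrt_divide)
  also have "\<dots> \<le> 35 * (16 * t) + 8 * sqrt (t ^ 3) * (2 * sqrt (16 * t))"
  proof (intro add_mono mult_left_mono)
    have "sqrt (real m) \<le> sqrt (16 * t)"
      using m by simp
    then show "(\<Sum>k=1..m. 1 / sqrt (real k)) \<le> 2 * sqrt (16 * t)"
      using sum_inverse_sqrt_le[of m] by linarith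
  qed (use m assms(1) in auto)
  \<comment> \<open>The inverse square roots sum to order \<open>sqrt t\<close>, which turns
    \<open>sqrt (t ^ 3)\<close> into the exact power \<open>t^2\<close>.\<close>
  also have "8 * sqrt (t ^ 3) * (2 * sqrt (16 * t)) = 16 * sqrt (t ^ 3 * (16 * t))"
    by (simp only: real_sqrt_mult)
  also have "t ^ 3 * (16 * t) = (4 * t\<^sup>2)\<^sup>2"
    by (simp add: power2_eq_square power3_eq_cube)
  also have "sqrt \<dots> = 4 * t\<^sup>2"
    by (rule real_sqrt_unique) auto
  finally have "real (card (SIGMA k:I. F k)) \<le> 1120 * t + 128 * t\<^sup>2"
    by simp
  moreover have "t * 1 \<le> t * t"
    using assms(1) by (intro mult_left_mono) auto
  ultimately show "card (SIGMA k:I. F k) \<le> 1248 * t\<^sup>2"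
    by (simp add: power2_eq_square)
qed

section \<open>Fibres and balanced generators\<close>

text \<open>The infimum is positive, so some element lies below twice its value.\<close>

lemma near_minimum:
  fixes S :: "real set"
  assumes "S \<noteq> {}" "\<And>s. s \<in> S \<Longrightarrow> 1 \<le> s"
  obtains s where "s \<in> S" "\<And>u. u \<in> S \<Longrightarrow> s \<le> 2 * u"
proof -
  have bdd: "bdd_below S"
    using assms(2) by (rule bdd_belowI)
  have "1 \<le> Inf S"
    using assms by (rule cInf_greatest)
  then obtain s where "s \<in> S" "s < 2 * Inf S"
    using cInf_lessD[of S "2 * Inf S"] assms(1) by auto
  moreover have "Inf S \<le> u" if "u \<in> S" for u
    using that bdd by (rule cInf_lower)
  ultimately show ?thesis
    using that by force
qed

text \<open>The inequality behind \<open>balanced_first_le\<close>, with \<open>b\<close> for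
  \<open>ra\<close>. It suffices to bound \<open>A * A\<close>: if \<open>A\<close> is comparable to
  \<open>B\<close> or \<open>C\<close>, multiply by the matching inequality in \<open>far\<close>;
  otherwise multiply the two alternatives with factor \<open>4 * b\<close>.\<close>

lemma balanced_cube_le:
  fixes A B C b :: real
  assumes nonneg: "0 \<le> A" "0 \<le> B" "0 \<le> C" and "B \<le> A" "C \<le> A"
    and tie: "A \<le> 4 * b * B \<or> A \<le> 4 * C" "A \<le> 4 * b * C \<or> A \<le> 2 * B"
    and far: "A \<le> 8 * b\<^sup>2 * B" "A \<le> 8 * b\<^sup>2 * C"
    and "1 \<le> b"
  shows "A ^ 3 \<le> 32 * b\<^sup>2 * (A * B * C)"
proof -
  have pos: "0 \<le> b\<^sup>2 * (B * C)"
    using assms by simp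
  consider "A \<le> 4 * C" | "A \<le> 2 * B" | "A \<le> 4 * b * B" "A \<le> 4 * b * C"
    using tie by blast
  then have "A * A \<le> 32 * b\<^sup>2 * (B * C)"
  proof cases
    case 1
    have "A * A \<le> (8 * b\<^sup>2 * B) * (4 * C)"
      by (rule mult_mono[OF far(1) 1]) (use nonneg in simp_all)
    then show ?thesis
      by (simp add: algebra_simps)
  next
    case 2
    have "A * A \<le> (8 * b\<^sup>2 * C) * (2 * B)"
      by (rule mult_mono[OF far(2) 2]) (use nonneg in simp_all)
    also have "\<dots> = 16 * (b\<^sup>2 * (B * C))"
      by (simp add: algebra_simps)
    finally show ?thesis
      using pos by linarith
  next
    case 3
    have "A * A \<le> (4 * b * B) * (4 * b * C)"
      by (rule mult_mono[OF 3]) (use nonneg \<open>1 \<le> b\<close> in simp_all)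
    also have "\<dots> = 16 * (b\<^sup>2 * (B * C))"
      by (simp add: power2_eq_square algebra_simps)
    finally show ?thesis
      using pos by linarith
  qed
  then have "A * (A * A) \<le> A * (32 * b\<^sup>2 * (B * C))"
    using nonneg(1) by (rule mult_left_mono)
  then show ?thesis
    by (simp add: power3_eq_cube algebra_simps)
qed

lemma scaled_ge:
  fixes c d v m :: real
  assumes "c \<le> \<bar>d\<bar>" "m \<le> \<bar>v\<bar>" "0 \<le> c" "0 \<le> m"
  shows "c * m \<le> \<bar>d * v\<bar>"
  unfolding abs_mult using assms by (intro mult_mono) auto

section \<open>Counting the rational coordinate when the other two are fixed\<close>

context simplest_cubic
begin

text \<open>Changing \<open>x\<close> translates all three conjugates by the same amount, so the
  conjugates at \<open>x = 0\<close> serve as the shifts.\<close>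

definition fibre :: "real \<Rightarrow> int \<Rightarrow> int \<Rightarrow> int set" where
  "fibre L y z = cubic_small (ev r1 0 y z) (ev r2 0 y z) (ev r3 0 y z) L"

lemma mem_fibre_iff: "x \<in> fibre L y z \<longleftrightarrow> \<bar>ev r1 x y z * ev r2 x y z * ev r3 x y z\<bar> \<le> L"
  by (simp add: fibre_def cubic_small_def ev_def abs_mult add.assoc)

lemma root_gaps: "ra \<le> \<bar>r1 - r2\<bar>" "ra \<le> \<bar>r1 - r3\<bar>" "1 / 2 \<le> \<bar>r2 - r3\<bar>"
  "\<bar>r3\<bar> \<le> 1 / ra" "\<bar>r3\<bar> \<le> 1 / 1000" "\<bar>1 + r2\<bar> \<le> 1 / ra"
proof -
  show 1: "\<bar>r3\<bar> \<le> 1 / ra"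
    using r3_bounds by auto
  have "1 / ra \<le> 1 / 1000"
    using real_a_ge by (intro divide_left_mono) auto
  then show 2: "\<bar>r3\<bar> \<le> 1 / 1000"
    using 1 by linarith
  show "ra \<le> \<bar>r1 - r2\<bar>" "ra \<le> \<bar>r1 - r3\<bar>"
    using r1_gt r2_bounds r3_bounds by linarith+
  show "1 / 2 \<le> \<bar>r2 - r3\<bar>"
    using 2 r2_bounds by linarith
  have "1 / r1 \<le> 1 / ra"
    using r1_gt real_a_ge by (intro divide_left_mono) auto
  then show "\<bar>1 + r2\<bar> \<le> 1 / ra"
    using r1_pos by (simp add: r2_eq)
qed

text \<open>Since \<open>r3\<close>, \<open>r2\<close>, \<open>r1\<close> are near \<open>0\<close>,
  \<open>-1\<close>, \<open>a\<close>, the differences of conjugates are near \<open>a * w\<close>,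
  \<open>a * (w + z)\<close>, \<open>a * z\<close> in size. These integers are nonzero, so all gaps
  are at least \<open>ra / 4\<close>.\<close>

lemma card_fibre_separated:
  assumes t: "1 \<le> t" "t ^ 3 \<le> ra"
    and nz: "z \<noteq> 0" "y + z * a \<noteq> 0" "y + z * a + z \<noteq> 0"
    and small: "\<bar>real_of_int z\<bar> \<le> 16 * t" "\<bar>real_of_int (y + z * a)\<bar> \<le> 16 * t"
  shows "finite (fibre (ra * t ^ 3) y z) \<and> card (fibre (ra * t ^ 3) y z) \<le> (387 :: real)"
proof -
  let ?w = "real_of_int y + real_of_int z * ra"
  have t': "16 * t \<le> ra / 4"
    using hundred_times_le[OF t real_a_ge] t by linarith
  have w: "1 \<le> \<bar>?w\<bar>" "1 \<le> \<bar>?w + z\<bar>" "1 \<le> \<bar>real_of_int z\<bar>" "\<bar>?w\<bar> \<le> ra / 4"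
  proof -
    have "1 \<le> \<bar>real_of_int (y + z * a)\<bar>" "1 \<le> \<bar>real_of_int (y + z * a + z)\<bar>"
      "1 \<le> \<bar>real_of_int z\<bar>"
      using nz by linarith+
    then show "1 \<le> \<bar>?w\<bar>" "1 \<le> \<bar>?w + z\<bar>" "1 \<le> \<bar>real_of_int z\<bar>" "\<bar>?w\<bar> \<le> ra / 4"
      using small(2) t' by simp_all
  qed
  \<comment> \<open>As \<open>z\<close> is at most \<open>ra / 4\<close>, replacing
    \<open>r3\<close> by \<open>0\<close> or \<open>r2\<close> by \<open>-1\<close> costs at most
    \<open>1 / 4\<close>.\<close>
  have e: "\<bar>z * v\<bar> \<le> 1 / 4" if "\<bar>v\<bar> \<le> 1 / ra" for v :: real
  proof -
    have "\<bar>z * v\<bar> \<le> (ra / 4) * (1 / ra)"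
      unfolding abs_mult using that small(1) t' by (intro mult_mono) auto
    then show ?thesis
      using real_a_ge by simp
  qed
  have "1 / 2 \<le> \<bar>?w - z * r3\<bar>"
    using w e[OF root_gaps(4)] by linarith
  then have 1: "ra * (1 / 2) \<le> \<bar>(r1 - r2) * (?w - z * r3)\<bar>"
    using root_gaps(1) real_a_ge by (intro scaled_ge) auto
  have "?w - z * r2 = ?w + z - z * (1 + r2)"
    by (simp add: algebra_simps)
  then have "1 / 2 \<le> \<bar>?w - z * r2\<bar>"
    using w e[OF root_gaps(6)] by linarith
  then have 2: "ra * (1 / 2) \<le> \<bar>(r1 - r3) * (?w - z * r2)\<bar>"
    using root_gaps(2) real_a_ge by (intro scaled_ge) auto
  have "1 * ra \<le> \<bar>real_of_int z * r1\<bar>"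
    unfolding abs_mult using w r1_gt real_a_ge by (intro mult_mono) auto
  then have "ra / 2 \<le> \<bar>?w - z * r1\<bar>"
    using w by linarith
  then have "1 / 2 * (ra / 2) \<le> \<bar>(r2 - r3) * (?w - z * r1)\<bar>"
    using root_gaps(3) real_a_ge by (intro scaled_ge) auto
  then have 3: "ra / 4 \<le> \<bar>(r2 - r3) * (?w - z * r1)\<bar>"
    by simp
  have "ra * t ^ 3 \<le> ra * ra"
    using t real_a_ge by (intro mult_left_mono) auto
  \<comment> \<open>This is the hypothesis on \<open>R\<close> for \<open>D = ra / 4\<close> and
    \<open>R = 64\<close>, whence \<open>387 = 6 * 64 + 3\<close>.\<close>
  then have "4 * (ra * t ^ 3) \<le> 64 * (ra / 4)\<^sup>2"
    by (simp add: power2_eq_square)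
  then show ?thesis
    unfolding fibre_def
    using card_cubic_small_separated[of "ra / 4" "ev r1 0 y z" "ev r2 0 y z" "ev r3 0 y z" "ra * t ^ 3" 64]
      1 2 3 real_a_ge unfolding ev_diffs by simp
qed

text \<open>An instance of \<open>card_cubic_small_far\<close> with \<open>D = ra * k / 2\<close>,
  \<open>R = 16\<close> and \<open>Q = 2 * sqrt (t ^ 3 / k)\<close>; then
  \<open>2 * R + 3 = 35\<close>.\<close>

lemma card_far_le:
  fixes b1 b2 b3 k t :: real
  assumes t: "1 \<le> t" "t ^ 3 \<le> ra" and k: "1 \<le> k"
    and far: "ra * k / 2 \<le> \<bar>b1 - b3\<bar>" "ra * k / 2 \<le> \<bar>b2 - b3\<bar>"
  shows "finite (cubic_small b1 b2 b3 (ra * t ^ 3)) \<and>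
    card (cubic_small b1 b2 b3 (ra * t ^ 3)) \<le> 35 + 8 * sqrt (t ^ 3 / k)"
proof -
  have "1 * 1 \<le> k * k"
    using k by (intro mult_mono) auto
  then have "t ^ 3 * 1 \<le> ra * (k * k)"
    using t real_a_ge by (intro mult_mono) auto
  then have "ra * t ^ 3 \<le> ra * (ra * (k * k))"
    using real_a_ge by (intro mult_left_mono) auto
  then have R: "4 * (ra * t ^ 3) \<le> 16 * (ra * k / 2)\<^sup>2"
    by (simp add: power2_eq_square algebra_simps)
  have "(2 * sqrt (t ^ 3 / k))\<^sup>2 = 4 * (t ^ 3 / k)"
    using t k by (simp add: power_mult_distrib)
  then have Q: "2 * (ra * t ^ 3) \<le> (2 * sqrt (t ^ 3 / k))\<^sup>2 * (ra * k / 2)"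
    using k by simp
  show ?thesis
    using card_cubic_small_far[OF far _ R _ Q] t k real_a_ge by simp
qed

text \<open>The lines are \<open>w = 0\<close>, \<open>z = 0\<close> and \<open>w + z = 0\<close>.
  On each, two conjugates may be close, namely the first and second, the second and third, and the
  first and third; the isolated one is moved to the last place for
  \<open>card_far_le\<close>.\<close>

lemma card_fibre_degenerate:
  fixes k :: int and t L M :: real
  assumes t: "1 \<le> t" "t ^ 3 \<le> ra" and "k \<noteq> 0"
  defines "L \<equiv> ra * t ^ 3" and "M \<equiv> 35 + 8 * sqrt (t ^ 3 / \<bar>real_of_int k\<bar>)"
  shows "finite (fibre L (- k * a) k) \<and> card (fibre L (- k * a) k) \<le> M"
    and "finite (fibre L k 0) \<and> card (fibre L k 0) \<le> M"
    and "finite (fibre L (- k - k * a) k) \<and> card (fibre L (- k - k * a) k) \<le> M"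
proof -
  define h where "h = \<bar>real_of_int k\<bar>"
  have h: "1 \<le> h"
    unfolding h_def using \<open>k \<noteq> 0\<close> by linarith
  note gaps = root_gaps(1-3)
  have kr1: "h * ra \<le> \<bar>k * r1\<bar>" "h * ra \<le> \<bar>k * (1 + r1)\<bar>"
    unfolding abs_mult h_def using r1_gt real_a_ge by (intro mult_left_mono; simp)+
  have kr2: "h * 1 \<le> \<bar>k * r2\<bar>"
    unfolding abs_mult h_def using r2_bounds by (intro mult_left_mono) auto
  have kr3: "h * (1 / 2) \<le> \<bar>k * (1 + r3)\<bar>"
    unfolding abs_mult h_def using root_gaps(5) by (intro mult_left_mono) auto
  have c: "\<bar>real_of_int (- k * a) + k * ra - k * r\<bar> = \<bar>k * r\<bar>"
    "\<bar>real_of_int (- k - k * a) + k * ra - k * r\<bar> = \<bar>k * (1 + r)\<bar>" for r :: real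
    by (simp_all add: algebra_simps abs_if)
  have hr: "0 \<le> h * ra" "0 \<le> h" "0 \<le> ra"
    using h real_a_ge by auto
  show "finite (fibre L (- k * a) k) \<and> card (fibre L (- k * a) k) \<le> M"
    unfolding fibre_def L_def M_def h_def[symmetric]
  proof (rule card_far_le[OF t h])
    show "ra * h / 2 \<le> \<bar>ev r1 0 (- k * a) k - ev r3 0 (- k * a) k\<bar>"
      using scaled_ge[OF gaps(2), of h "real_of_int (- k * a) + k * ra - k * r2"] kr2 hr
      unfolding ev_diffs c by simp
    show "ra * h / 2 \<le> \<bar>ev r2 0 (- k * a) k - ev r3 0 (- k * a) k\<bar>"
      using scaled_ge[OF gaps(3), of "h * ra" "real_of_int (- k * a) + k * ra - k * r1"] kr1 hr
      unfolding ev_diffs c by (simp add: mult.commute)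
  qed
  have "finite (cubic_small (ev r2 0 k 0) (ev r3 0 k 0) (ev r1 0 k 0) L)
      \<and> card (cubic_small (ev r2 0 k 0) (ev r3 0 k 0) (ev r1 0 k 0) L) \<le> M"
    unfolding L_def M_def h_def[symmetric]
  proof (rule card_far_le[OF t h])
    have "ra * h / 2 \<le> \<bar>ev r1 0 k 0 - ev r2 0 k 0\<bar>" "ra * h / 2 \<le> \<bar>ev r1 0 k 0 - ev r3 0 k 0\<bar>"
      using scaled_ge[OF gaps(1), of h "real_of_int k"] scaled_ge[OF gaps(2), of h "real_of_int k"] hr
      unfolding ev_diffs by (simp_all add: h_def)
    then show "ra * h / 2 \<le> \<bar>ev r2 0 k 0 - ev r1 0 k 0\<bar>" "ra * h / 2 \<le> \<bar>ev r3 0 k 0 - ev r1 0 k 0\<bar>"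
      by linarith+
  qed
  then show "finite (fibre L k 0) \<and> card (fibre L k 0) \<le> M"
    unfolding fibre_def using cubic_small_commute by metis
  have "finite (cubic_small (ev r1 0 (- k - k * a) k) (ev r3 0 (- k - k * a) k)
        (ev r2 0 (- k - k * a) k) L)
      \<and> card (cubic_small (ev r1 0 (- k - k * a) k) (ev r3 0 (- k - k * a) k)
        (ev r2 0 (- k - k * a) k) L) \<le> M"
    unfolding L_def M_def h_def[symmetric]
  proof (rule card_far_le[OF t h])
    show "ra * h / 2 \<le> \<bar>ev r1 0 (- k - k * a) k - ev r2 0 (- k - k * a) k\<bar>"
      using scaled_ge[OF gaps(1), of "h * (1 / 2)" "real_of_int (- k - k * a) + k * ra - k * r3"]
        kr3 hr unfolding ev_diffs c by simp
    have "ra * h / 2 \<le> \<bar>ev r2 0 (- k - k * a) k - ev r3 0 (- k - k * a) k\<bar>"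
      using scaled_ge[OF gaps(3), of "h * ra" "real_of_int (- k - k * a) + k * ra - k * r1"] kr1 hr
      unfolding ev_diffs c by (simp add: mult.commute)
    then show "ra * h / 2 \<le> \<bar>ev r3 0 (- k - k * a) k - ev r2 0 (- k - k * a) k\<bar>"
      by linarith
  qed
  then show "finite (fibre L (- k - k * a) k) \<and> card (fibre L (- k - k * a) k) \<le> M"
    unfolding fibre_def using cubic_small_commute by metis
qed

section \<open>Units and generators of nearly minimal size\<close>

definition unit3 :: "real \<Rightarrow> real \<Rightarrow> real \<Rightarrow> bool" where
  "unit3 u1 u2 u3 \<longleftrightarrow> conj3 u1 u2 u3 \<and> conj3 (1 / u1) (1 / u2) (1 / u3) \<and>
     u1 \<noteq> 0 \<and> u2 \<noteq> 0 \<and> u3 \<noteq> 0"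

lemma unit3_rot: "unit3 u1 u2 u3 \<Longrightarrow> unit3 u2 u3 u1"
  unfolding unit3_def using conj3_rot by blast

lemma unit3_inverse: "unit3 u1 u2 u3 \<Longrightarrow> unit3 (1 / u1) (1 / u2) (1 / u3)"
  by (simp add: unit3_def)

lemma unit3_mult:
  assumes "unit3 u1 u2 u3" "unit3 v1 v2 v3"
  shows "unit3 (u1 * v1) (u2 * v2) (u3 * v3)"
  using conj3_mult[of u1 u2 u3 v1 v2 v3]
    conj3_mult[of "1 / u1" "1 / u2" "1 / u3" "1 / v1" "1 / v2" "1 / v3"] assms
  by (simp add: unit3_def)

text \<open>The product of the roots is 1, so each inverse is the product of the other two
  roots.\<close>

lemma unit3_roots: "unit3 r1 r2 r3"
proof -
  have nz: "r1 \<noteq> 0" "r2 \<noteq> 0" "r3 \<noteq> 0"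
    using prod_roots by auto
  have "1 / r1 = r2 * r3" "1 / r2 = r3 * r1" "1 / r3 = r1 * r2"
    using prod_roots nz by (simp_all add: field_simps)
  then show ?thesis
    unfolding unit3_def using nz conj3_roots
      conj3_mult[OF conj3_rot[OF conj3_roots] conj3_rot2[OF conj3_roots]] by simp
qed

definition max3 :: "real \<Rightarrow> real \<Rightarrow> real \<Rightarrow> real" where
  "max3 A B C = max \<bar>A\<bar> (max \<bar>B\<bar> \<bar>C\<bar>)"

lemma max3_rot: "max3 A B C = max3 B C A"
  by (simp add: max3_def max.commute max.left_commute)

text \<open>The factor \<open>2\<close> makes the existence of such a generator immediate from the infimum, so that no finiteness
  of lattice points in boxes is needed.\<close>

definition balanced :: "real \<Rightarrow> real \<Rightarrow> real \<Rightarrow> bool" where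
  "balanced A B C \<longleftrightarrow>
     (\<forall>u1 u2 u3. unit3 u1 u2 u3 \<longrightarrow> max3 A B C \<le> 2 * max3 (A * u1) (B * u2) (C * u3))"

lemma balanced_rot:
  assumes "balanced A B C"
  shows "balanced B C A"
  unfolding balanced_def
proof (intro allI impI)
  fix u1 u2 u3
  assume "unit3 u1 u2 u3"
  then have "unit3 u3 u1 u2"
    using unit3_rot by blast
  then have "max3 A B C \<le> 2 * max3 (A * u3) (B * u1) (C * u2)"
    using assms by (simp add: balanced_def)
  then show "max3 B C A \<le> 2 * max3 (B * u1) (C * u2) (A * u3)"
    using max3_rot[of A B C] max3_rot[of "A * u3" "B * u1" "C * u2"] by simp
qed

lemma root_abs_bounds:
  "\<bar>r1\<bar> \<le> 2 * ra" "\<bar>r2\<bar> \<le> 2" "\<bar>r3\<bar> \<le> 1 / ra"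
  "\<bar>1 / r1\<bar> \<le> 1 / ra" "\<bar>1 / r2\<bar> \<le> 1" "\<bar>1 / r3\<bar> \<le> 2 * ra"
proof -
  show "\<bar>r1\<bar> \<le> 2 * ra" "\<bar>r2\<bar> \<le> 2" "\<bar>r3\<bar> \<le> 1 / ra"
    using r1_gt r1_lt real_a_ge r2_bounds root_gaps(4) by linarith+
  show "\<bar>1 / r1\<bar> \<le> 1 / ra"
    using r1_gt real_a_ge by (auto intro!: divide_left_mono)
  show "\<bar>1 / r2\<bar> \<le> 1"
    using r2_bounds by (subst abs_divide, subst divide_le_eq_1) auto
  have "1 / r3 = - (1 + r1)"
    by (simp add: r3_eq)
  then show "\<bar>1 / r3\<bar> \<le> 2 * ra"
    using r1_gt r1_lt real_a_ge by linarith
qed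

text \<open>A generator with one dominant conjugate could be shrunk by a unit that is small there.
  Testing four such units yields the hypotheses of \<open>balanced_cube_le\<close>.\<close>

lemma balanced_first_le:
  assumes bal: "balanced A B C" and max: "\<bar>B\<bar> \<le> \<bar>A\<bar>" "\<bar>C\<bar> \<le> \<bar>A\<bar>"
  shows "\<bar>A\<bar> ^ 3 \<le> 32 * ra\<^sup>2 * \<bar>A * B * C\<bar>"
proof (cases "A = 0")
  case False
  \<comment> \<open>Multiplication by \<open>u1\<close> more than halves the first entry, so
    near-minimality can only be met by the second or the third.\<close>
  have step: "\<bar>A\<bar> \<le> 2 * c2 * \<bar>B\<bar> \<or> \<bar>A\<bar> \<le> 2 * c3 * \<bar>C\<bar>"
    if "unit3 u1 u2 u3" "\<bar>u1\<bar> \<le> 2 / ra" "\<bar>u2\<bar> \<le> c2" "\<bar>u3\<bar> \<le> c3" for u1 u2 u3 c2 c3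
  proof -
    have "max3 A B C \<le> 2 * max3 (A * u1) (B * u2) (C * u3)"
      using bal that(1) by (simp add: balanced_def)
    then have "\<bar>A\<bar> \<le> 2 * \<bar>A * u1\<bar> \<or> \<bar>A\<bar> \<le> 2 * \<bar>B * u2\<bar> \<or> \<bar>A\<bar> \<le> 2 * \<bar>C * u3\<bar>"
      unfolding max3_def by linarith
    moreover have "2 * \<bar>A * u1\<bar> < \<bar>A\<bar>"
    proof -
      have "2 / ra < 1 / 2"
        using real_a_ge by (simp add: field_simps)
      then have "\<bar>A\<bar> * \<bar>u1\<bar> < \<bar>A\<bar> * (1 / 2)"
        using that(2) False by (intro mult_strict_left_mono) auto
      then show ?thesis
        by (simp add: abs_mult)
    qed
    moreover have "\<bar>B * u2\<bar> \<le> c2 * \<bar>B\<bar>" "\<bar>C * u3\<bar> \<le> c3 * \<bar>C\<bar>"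
      using mult_right_mono[OF that(3), of "\<bar>B\<bar>"] mult_right_mono[OF that(4), of "\<bar>C\<bar>"]
      by (simp_all add: abs_mult mult.commute)
    ultimately show ?thesis
      by linarith
  qed
  note b = root_abs_bounds
  have ra': "1 / ra \<le> 2 / ra"
    using real_a_ge by (simp add: field_simps)
  have prod: "\<bar>u * v\<bar> \<le> c * d" if "\<bar>u\<bar> \<le> c" "\<bar>v\<bar> \<le> d" for u v c d :: real
    unfolding abs_mult using that by (intro mult_mono) auto
  \<comment> \<open>This unit has conjugates of size at most \<open>1 / ra\<close>,
    \<open>2 * ra\<close>, \<open>2\<close>; the inverse root used next has \<open>1 / ra\<close>,
    \<open>1\<close>, \<open>2 * ra\<close>.\<close>
  have "unit3 r3 r1 r2"
    using unit3_rot unit3_roots by blast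
  from step[OF this _ b(1,2)] have 1: "\<bar>A\<bar> \<le> 4 * ra * \<bar>B\<bar> \<or> \<bar>A\<bar> \<le> 4 * \<bar>C\<bar>"
    using b ra' by auto
  from step[OF unit3_inverse[OF unit3_roots] _ b(5,6)]
  have 2: "\<bar>A\<bar> \<le> 4 * ra * \<bar>C\<bar> \<or> \<bar>A\<bar> \<le> 2 * \<bar>B\<bar>"
    using b ra' by auto
  \<comment> \<open>An alternative with a factor of order \<open>1 / ra\<close> is impossible,
    because \<open>A\<close> is the largest entry.\<close>
  have absorb: False if "\<bar>A\<bar> \<le> 2 * (2 / ra) * c" "c \<le> \<bar>A\<bar>" for c
  proof -
    have "2 * (2 / ra) * c \<le> 2 * (2 / ra) * \<bar>A\<bar>"
      using that real_a_ge by (intro mult_left_mono) auto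
    also have "\<dots> < 1 * \<bar>A\<bar>"
      using False real_a_ge by (intro mult_strict_right_mono) (auto simp: field_simps)
    finally show False
      using that by simp
  qed
  \<comment> \<open>Chosen to be small in the first and third place and of order \<open>ra^2\<close>
    in the second, so that only the inequality with \<open>B\<close> survives.\<close>
  have u: "unit3 (r3 * (1 / r2)) (r1 * (1 / r3)) (r2 * (1 / r1))"
    by (intro unit3_mult unit3_rot[OF unit3_rot[OF unit3_roots]]
        unit3_inverse[OF unit3_rot[OF unit3_roots]])
  have "\<bar>A\<bar> \<le> 2 * (2 * ra * (2 * ra)) * \<bar>B\<bar> \<or> \<bar>A\<bar> \<le> 2 * (2 * (1 / ra)) * \<bar>C\<bar>"
    by (rule step[OF u order_trans[OF prod[OF b(3,5)]] prod[OF b(1,6)] prod[OF b(2,4)]])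
      (use ra' in simp)
  then have 3: "\<bar>A\<bar> \<le> 8 * ra\<^sup>2 * \<bar>B\<bar>"
    using absorb[of "\<bar>C\<bar>"] max by (auto simp: power2_eq_square)
  \<comment> \<open>The same with the second and third places exchanged, which leaves the inequality
    with \<open>C\<close>.\<close>
  have u: "unit3 (r2 * (1 / r1)) (r3 * (1 / r2)) (r1 * (1 / r3))"
    by (rule unit3_mult[OF unit3_rot[OF unit3_roots] unit3_inverse[OF unit3_roots]])
  have "\<bar>A\<bar> \<le> 2 * (1 / ra * 1) * \<bar>B\<bar> \<or> \<bar>A\<bar> \<le> 2 * (2 * ra * (2 * ra)) * \<bar>C\<bar>"
    by (rule step[OF u order_trans[OF prod[OF b(2,4)]] prod[OF b(3,5)] prod[OF b(1,6)]]) simp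
  moreover have False if "\<bar>A\<bar> \<le> 2 * (1 / ra * 1) * \<bar>B\<bar>"
  proof (rule absorb[OF _ max(1)])
    have "2 * (1 / ra * 1) * \<bar>B\<bar> \<le> 2 * (2 / ra) * \<bar>B\<bar>"
      using ra' by (intro mult_right_mono) auto
    then show "\<bar>A\<bar> \<le> 2 * (2 / ra) * \<bar>B\<bar>"
      using that by linarith
  qed
  ultimately have 4: "\<bar>A\<bar> \<le> 8 * ra\<^sup>2 * \<bar>C\<bar>"
    by (auto simp: power2_eq_square)
  show ?thesis
    unfolding abs_mult
    by (rule balanced_cube_le[OF _ _ _ max 1 2 3 4]) (use real_a_ge in auto)
qed simp

lemma balanced_le:
  assumes "balanced A B C"
  shows "max3 A B C ^ 3 \<le> 32 * ra\<^sup>2 * \<bar>A * B * C\<bar>"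
proof -
  consider "\<bar>B\<bar> \<le> \<bar>A\<bar>" "\<bar>C\<bar> \<le> \<bar>A\<bar>" | "\<bar>C\<bar> \<le> \<bar>B\<bar>" "\<bar>A\<bar> \<le> \<bar>B\<bar>" | "\<bar>A\<bar> \<le> \<bar>C\<bar>" "\<bar>B\<bar> \<le> \<bar>C\<bar>"
    by linarith
  then show ?thesis
  proof cases
    case 1
    then show ?thesis
      using balanced_first_le[OF assms] by (simp add: max3_def)
  next
    case 2
    then show ?thesis
      using balanced_first_le[OF balanced_rot[OF assms]] by (simp add: max3_def mult_ac)
  next
    case 3
    then show ?thesis
      using balanced_first_le[OF balanced_rot[OF balanced_rot[OF assms]]]
      by (simp add: max3_def mult_ac)
  qed
qed

end

section \<open>Upper bound\<close>

context monogenic_simplest_cubic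
begin

lemma gens_unit:
  assumes g: "(A, B, C) \<in> gens L" and u: "unit3 u1 u2 u3"
  shows "(A * u1, B * u2, C * u3) \<in> gens L" "pideal (A * u1) = pideal A"
proof -
  have c: "conj3 A B C" and A: "A \<noteq> 0" "primitive_elt A" "\<bar>A * B * C\<bar> \<le> L"
    using g by (auto simp: gens_def)
  have c': "conj3 (A * u1) (B * u2) (C * u3)" and nz: "A * u1 \<noteq> 0"
    using conj3_mult[OF c] u A by (auto simp: unit3_def)
  have mem: "A \<in> Zr" "A * u1 \<in> Zr" "u1 \<in> Zr" "1 / u1 \<in> Zr"
    using conj3_mem c c' u unfolding unit3_def by blast+
  have "A = A * u1 * (1 / u1)"
    using u by (simp add: unit3_def)
  then show eq: "pideal (A * u1) = pideal A"
    using pideal_subset_iff[OF mem(1)] pideal_subset_iff[OF mem(2)] mem by blast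
  have "primitive_elt (A * u1)"
    using A(2) primitive_pideal_iff[OF mem(1)] primitive_pideal_iff[OF mem(2)] eq by simp
  \<comment> \<open>Both absolute norms are the index of the same ideal.\<close>
  moreover have "\<bar>A * u1 * (B * u2) * (C * u3)\<bar> = \<bar>A * B * C\<bar>"
    using ideal_norm_pideal[of A] ideal_norm_pideal[of "A * u1"] eq
    by (simp flip: index_eq_norm[OF c A(1)] index_eq_norm[OF c' nz])
  ultimately show "(A * u1, B * u2, C * u3) \<in> gens L"
    using c' nz A(3) unfolding gens_def by simp
qed

text \<open>Take a generator of \<open>I\<close> whose largest conjugate is within a factor 2 of the
  infimum; unit multiples of it are again generators of \<open>I\<close> and compete in that
  infimum.\<close>

lemma ex_balanced_generator:
  assumes "I \<in> ideals L"
  obtains A B C where "(A, B, C) \<in> gens L" "I = pideal A" "balanced A B C"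
proof -
  define S where "S = {max3 A B C | A B C. (A, B, C) \<in> gens L \<and> I = pideal A}"
  obtain p where "p \<in> gens L" "I = pideal (fst p)"
    using assms unfolding ideals_eq by blast
  then have "S \<noteq> {}"
    by (cases p) (auto simp: S_def)
  \<comment> \<open>The norm is a nonzero integer, so the three conjugates cannot all be below 1 in
    absolute value.\<close>
  moreover have "1 \<le> s" if "s \<in> S" for s
  proof (rule ccontr)
    assume "\<not> 1 \<le> s"
    obtain A B C where s: "s = max3 A B C" and g: "(A, B, C) \<in> gens L"
      using \<open>s \<in> S\<close> unfolding S_def by blast
    have c: "conj3 A B C" and "A \<noteq> 0"
      using g by (auto simp: gens_def)
    then have nz: "A * B * C \<noteq> 0"
      using conj3_zero_iff[OF c] by simp
    obtain n :: int where n: "A * B * C = n"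
      using norm_int[OF c] .
    then have "1 \<le> \<bar>A * B * C\<bar>"
      using nz by (simp add: int_one_le_iff_zero_less)
    moreover have "\<bar>A\<bar> < 1" "\<bar>B\<bar> \<le> 1" "\<bar>C\<bar> \<le> 1"
      using \<open>\<not> 1 \<le> s\<close> unfolding s max3_def by linarith+
    then have "\<bar>A\<bar> * \<bar>B\<bar> * \<bar>C\<bar> \<le> \<bar>A\<bar> * 1 * 1"
      by (intro mult_mono) auto
    ultimately show False
      using \<open>\<bar>A\<bar> < 1\<close> by (simp add: abs_mult)
  qed
  ultimately obtain s where s: "s \<in> S" "\<And>u. u \<in> S \<Longrightarrow> s \<le> 2 * u"
    using near_minimum by blast
  then obtain A B C where A: "s = max3 A B C" "(A, B, C) \<in> gens L" "I = pideal A"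
    by (auto simp: S_def)
  have "balanced A B C"
    unfolding balanced_def
  proof (intro allI impI)
    fix u1 u2 u3
    assume "unit3 u1 u2 u3"
    from gens_unit[OF A(2) this] have "max3 (A * u1) (B * u2) (C * u3) \<in> S"
      using A(3) unfolding S_def by blast
    then show "max3 A B C \<le> 2 * max3 (A * u1) (B * u2) (C * u3)"
      using s(2) A(1) by simp
  qed
  then show ?thesis
    using that A by blast
qed

lemma ideal_generator_coords:
  fixes t :: real
  assumes t: "1 \<le> t" and "I \<in> ideals (ra * t ^ 3)"
  obtains x y z where "I = pideal (ev r1 x y z)" "primitive_elt (ev r1 x y z)" "x \<in> fibre (ra * t ^ 3) y z"
    "\<bar>real_of_int z\<bar> \<le> 16 * t" "\<bar>real_of_int (y + z * a)\<bar> \<le> 16 * t"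
proof -
  obtain A B C where g: "(A, B, C) \<in> gens (ra * t ^ 3)" and I: "I = pideal A"
    and bal: "balanced A B C"
    using ex_balanced_generator[OF assms(2)] .
  obtain x y z where xyz: "A = ev r1 x y z" "B = ev r2 x y z" "C = ev r3 x y z"
    using g by (auto simp: gens_def conj3_def)
  have "max3 A B C ^ 3 \<le> 32 * ra\<^sup>2 * \<bar>A * B * C\<bar>"
    by (rule balanced_le[OF bal])
  also have "\<dots> \<le> 32 * ra\<^sup>2 * (ra * t ^ 3)"
    using g by (intro mult_left_mono) (auto simp: gens_def)
  \<comment> \<open>The constant 32 is rounded up to the cube \<open>64 = 4 ^ 3\<close>;
    \<open>coord_bounds\<close> then gives the \<open>16 * t\<close>.\<close>
  also have "\<dots> \<le> (4 * ra * t) ^ 3"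
    using t real_a_ge by (simp add: power2_eq_square power3_eq_cube)
  finally have "max3 A B C \<le> 4 * ra * t"
    using power_strict_mono[of "4 * ra * t" "max3 A B C" 3] t real_a_ge by force
  then have "\<bar>A\<bar> \<le> 4 * ra * t" "\<bar>B\<bar> \<le> 4 * ra * t" "\<bar>C\<bar> \<le> 4 * ra * t"
    unfolding max3_def by linarith+
  then have "ra * \<bar>real_of_int z\<bar> \<le> 4 * (4 * ra * t)" "ra * \<bar>y + z * ra\<bar> \<le> 4 * (4 * ra * t)"
    unfolding xyz by (rule coord_bounds)+
  then have "ra * \<bar>real_of_int z\<bar> \<le> ra * (16 * t)" "ra * \<bar>y + z * ra\<bar> \<le> ra * (16 * t)"
    by (simp_all add: mult_ac)
  then have "\<bar>real_of_int z\<bar> \<le> 16 * t" "\<bar>y + z * ra\<bar> \<le> 16 * t"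
    using real_a_ge by (simp_all only: mult_le_cancel_left_pos)
  moreover have "x \<in> fibre (ra * t ^ 3) y z"
    unfolding mem_fibre_iff using g xyz by (simp add: gens_def)
  ultimately show ?thesis
    using that I g xyz by (simp add: gens_def)
qed

lemma primitive_elt_of_int:
  assumes "primitive_elt (of_int n)" "n \<noteq> 0"
  shows "n = 1 \<or> n = - 1"
proof (rule ccontr)
  assume "\<not> (n = 1 \<or> n = - 1)"
  then have "\<bar>n\<bar> \<ge> 2"
    using assms(2) by linarith
  moreover have "real_of_int n = of_int \<bar>n\<bar> * of_int (sgn n)"
    by (auto simp: sgn_if abs_if)
  ultimately show False
    using assms(1) of_int_Zr unfolding primitive_elt_def by blast
qed

lemma upper_bound:
  fixes t :: real
  assumes t: "1 \<le> t" "t ^ 3 \<le> ra"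
  shows "finite (ideals (ra * t ^ 3)) \<and> card (ideals (ra * t ^ 3)) \<le> 425189 * t\<^sup>2"
proof -
  let ?L = "ra * t ^ 3"
  define K where "K = {k :: int. \<bar>real_of_int k\<bar> \<le> 16 * t}"
  define K' where "K' = {k :: int. k \<noteq> 0 \<and> \<bar>real_of_int k\<bar> \<le> 16 * t}"
  \<comment> \<open>The generic part is indexed by \<open>w = y + z * a\<close> in place of
    \<open>y\<close>, since \<open>w\<close> ranges over a short interval around 0.\<close>
  define F where "F = (\<lambda>(w, z). if z \<noteq> 0 \<and> w \<noteq> 0 \<and> w + z \<noteq> 0 then fibre ?L (w - z * a) z else {})"
  define T0 where "T0 = (SIGMA p:K \<times> K. F p)"
  define T1 where "T1 = (SIGMA k:K'. fibre ?L (- k * a) k)"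
  define T2 where "T2 = (SIGMA k:K'. fibre ?L k 0)"
  define T3 where "T3 = (SIGMA k:K'. fibre ?L (- k - k * a) k)"
  define g0 where "g0 = (\<lambda>((w, z), x). pideal (ev r1 x (w - z * a) z))"
  define g1 where "g1 = (\<lambda>(k, x). pideal (ev r1 x (- k * a) k))"
  define g2 where "g2 = (\<lambda>(k, x). pideal (ev r1 x k 0))"
  define g3 where "g3 = (\<lambda>(k, x). pideal (ev r1 x (- k - k * a) k))"
  have t2: "1 \<le> t\<^sup>2"
    using t by simp
  have K: "finite K" "real (card K) \<le> 33 * t"
    using finite_int_near[of 0 "16 * t"] card_int_near[of "16 * t" 0] t
    by (simp_all add: K_def)
  have F: "finite (F p) \<and> card (F p) \<le> (387 :: real)" if "p \<in> K \<times> K" for p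
  proof -
    obtain w z where p: "p = (w, z)"
      by (cases p)
    then show ?thesis
      using card_fibre_separated[OF t, of z "w - z * a"] that by (auto simp: F_def K_def)
  qed
  have T0: "finite T0"
    unfolding T0_def using K F by (intro finite_SigmaI) auto
  have "real (card T0) = (\<Sum>p\<in>K \<times> K. real (card (F p)))"
    unfolding T0_def using K F by (subst card_SigmaI) auto
  also have "\<dots> \<le> (\<Sum>p\<in>K \<times> K. 387)"
    using F by (intro sum_mono) auto
  also have "\<dots> = 387 * (real (card K) * real (card K))"
    by (simp add: card_cartesian_product)
  also have "\<dots> \<le> 387 * ((33 * t) * (33 * t))"
    using K t by (intro mult_left_mono mult_mono) auto
  also have "\<dots> = 421443 * t\<^sup>2"
    by (simp add: power2_eq_square)
  finally have card0: "real (card T0) \<le> 421443 * t\<^sup>2" .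
  have T1: "finite T1 \<and> card T1 \<le> 1248 * t\<^sup>2" and T2: "finite T2 \<and> card T2 \<le> 1248 * t\<^sup>2"
    and T3: "finite T3 \<and> card T3 \<le> 1248 * t\<^sup>2"
    unfolding T1_def T2_def T3_def K'_def
    by (rule card_degenerate_le[OF t(1)], rule card_fibre_degenerate[OF t], assumption)+
  \<comment> \<open>Overlaps between the pieces are harmless for an upper bound.\<close>
  let ?U = "{pideal 1, pideal (- 1)} \<union> (g0 ` T0 \<union> (g1 ` T1 \<union> (g2 ` T2 \<union> g3 ` T3)))"
  have sub: "ideals ?L \<subseteq> ?U"
  proof
    fix I
    assume "I \<in> ideals ?L"
    then obtain x y z where I: "I = pideal (ev r1 x y z)" and primitive_elt: "primitive_elt (ev r1 x y z)"
      and x: "x \<in> fibre ?L y z"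
      and z: "\<bar>real_of_int z\<bar> \<le> 16 * t" and w: "\<bar>real_of_int (y + z * a)\<bar> \<le> 16 * t"
      using ideal_generator_coords[OF t(1)] by blast
    \<comment> \<open>In order: rational generators, the lines \<open>w = 0\<close>,
      \<open>z = 0\<close>, \<open>w + z = 0\<close>, and the generic case.\<close>
    consider "y = 0" "z = 0" | "z \<noteq> 0" "y = - z * a" | "z = 0" "y \<noteq> 0"
      | "z \<noteq> 0" "y = - z - z * a" | "z \<noteq> 0" "y + z * a \<noteq> 0" "y + z * a + z \<noteq> 0"
      by (cases "z = 0"; cases "y + z * a = 0"; cases "y + z * a + z = 0"; cases "y = 0")
        (auto simp: algebra_simps)
    then show "I \<in> ?U"
    proof cases
      case 1
      then have e: "ev r1 x y z = of_int x"
        by (simp add: ev_def)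
      have "x \<noteq> 0"
      proof
        assume "x = 0"
        then have "primitive_elt 0"
          using primitive_elt e by simp
        then show False
          using O.zero_mem unfolding primitive_elt_def by (metis mult_zero_right order_refl)
      qed
      then have "x = 1 \<or> x = - 1"
        using primitive_elt primitive_elt_of_int e by simp
      then show ?thesis
        using I e by auto
    next
      case 2
      then have "(z, x) \<in> T1"
        using x z by (simp add: T1_def K'_def)
      moreover have "I = g1 (z, x)"
        using I 2 by (simp add: g1_def)
      ultimately show ?thesis
        by blast
    next
      case 3
      then have "(y, x) \<in> T2"
        using x w by (simp add: T2_def K'_def)
      moreover have "I = g2 (y, x)"
        using I 3 by (simp add: g2_def)
      ultimately show ?thesis
        by blast
    next
      case 4
      then have "(z, x) \<in> T3"
        using x z by (simp add: T3_def K'_def)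
      moreover have "I = g3 (z, x)"
        using I 4 by (simp add: g3_def)
      ultimately show ?thesis
        by blast
    next
      case 5
      then have "((y + z * a, z), x) \<in> T0"
        using x z w by (simp add: T0_def F_def K_def)
      moreover have "I = g0 ((y + z * a, z), x)"
        using I by (simp add: g0_def)
      ultimately show ?thesis
        by blast
    qed
  qed
  have finU: "finite ?U"
    using T0 T1 T2 T3 by simp
  have "card (ideals ?L) \<le> card ?U"
    using finU sub by (rule card_mono)
  also have "\<dots> \<le> card {pideal 1, pideal (- 1)} +
      (card (g0 ` T0) + (card (g1 ` T1) + (card (g2 ` T2) + card (g3 ` T3))))"
    by (intro order_trans[OF card_Un_le] add_left_mono order_refl)
  also have "\<dots> \<le> 2 + (card T0 + (card T1 + (card T2 + card T3)))"
    using T0 T1 T2 T3 by (intro add_mono card_image_le) (auto simp: card_insert_if)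
  finally have "real (card (ideals ?L)) \<le>
      2 + (real (card T0) + (real (card T1) + (real (card T2) + real (card T3))))"
    by (simp flip: of_nat_add)
  \<comment> \<open>The total is \<open>2 + 387 * 33^2 + 3 * 1248\<close>; the two rational
    generators are absorbed by \<open>1 \<le> t^2\<close>.\<close>
  also have "\<dots> \<le> 2 * t\<^sup>2 + (421443 * t\<^sup>2 + (1248 * t\<^sup>2 + (1248 * t\<^sup>2 + 1248 * t\<^sup>2)))"
    using t2 card0 T1 T2 T3 by (intro add_mono) auto
  finally show ?thesis
    using finU sub finite_subset t by auto
qed

end

theorem theorem1p3:
  fixes \<delta> :: real
  assumes "0 \<le> \<delta>" and "\<delta> \<le> 1"
  shows "(\<lambda>a::int. real (primitive_principal_count a (of_int a powr (1 + \<delta>))))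
           \<in> \<Theta>[inf at_top (principal monogenic_params)](\<lambda>a. of_int a powr (2 * \<delta> / 3))"
proof -
  have bounds: "real (primitive_principal_count a (of_int a powr (1 + \<delta>)))
        \<le> 425189 * of_int a powr (2 * \<delta> / 3)"
      "of_int a powr (2 * \<delta> / 3)
        \<le> 144 * real (primitive_principal_count a (of_int a powr (1 + \<delta>)))"
    if "a \<ge> 1000" "a \<in> monogenic_params" for a :: int
  proof -
    interpret monogenic_simplest_cubic a "rho a" "- 1 - 1 / rho a" "- 1 / (1 + rho a)"
      using that by unfold_locales auto
    \<comment> \<open>With this \<open>t\<close> the assumptions on \<open>\<delta>\<close> supply
      \<open>1 \<le> t\<close> and \<open>t ^ 3 \<le> ra\<close>, as both bounds require.\<close>
    define t where "t = ra powr (\<delta> / 3)"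
    have "ra powr 0 \<le> t"
      unfolding t_def using assms real_a_ge by (intro powr_mono) auto
    then have t1: "1 \<le> t"
      using real_a_ge by simp
    have t_power: "t ^ n = ra powr (n * (\<delta> / 3))" for n
      unfolding t_def using real_a_ge by (simp add: powr_power mult.commute)
    have "t ^ 3 = ra powr \<delta>"
      using t_power[of 3] by simp
    moreover have "ra powr \<delta> \<le> ra powr 1"
      using assms real_a_ge by (intro powr_mono) auto
    ultimately have t3: "t ^ 3 \<le> ra" and L: "ra powr (1 + \<delta>) = ra * t ^ 3"
      using real_a_ge by (simp_all add: powr_add)
    have t2: "ra powr (2 * \<delta> / 3) = t\<^sup>2"
      using t_power[of 2] by simp
    note upper = upper_bound[OF t1 t3]
    show "real (primitive_principal_count a (ra powr (1 + \<delta>))) \<le> 425189 * ra powr (2 * \<delta> / 3)"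
      unfolding primitive_principal_count_eq L t2 using upper by simp
    show "ra powr (2 * \<delta> / 3) \<le> 144 * real (primitive_principal_count a (ra powr (1 + \<delta>)))"
      unfolding primitive_principal_count_eq L t2 using lower_bound[OF _ t1 t3] upper by simp
  qed
  show ?thesis
  proof (rule bigthetaI)
    \<comment> \<open>In this filter \<open>a\<close> tends to infinity inside
      \<open>monogenic_params\<close>, so estimates for \<open>a \<ge> 1000\<close> in that set hold
      eventually.\<close>
    show "(\<lambda>a::int. real (primitive_principal_count a (of_int a powr (1 + \<delta>))))
        \<in> O[inf at_top (principal monogenic_params)](\<lambda>a. of_int a powr (2 * \<delta> / 3))"
      by (rule bigoI[where c = 425189], unfold eventually_inf_principal,
          rule eventually_mono[OF eventually_ge_at_top[of 1000]]) (use bounds(1) in auto)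
    have "(\<lambda>a::int. of_int a powr (2 * \<delta> / 3))
        \<in> O[inf at_top (principal monogenic_params)](\<lambda>a. real (primitive_principal_count a (of_int a powr (1 + \<delta>))))"
      by (rule bigoI[where c = 144], unfold eventually_inf_principal,
          rule eventually_mono[OF eventually_ge_at_top[of 1000]]) (use bounds(2) in auto)
    then show "(\<lambda>a::int. real (primitive_principal_count a (of_int a powr (1 + \<delta>))))
        \<in> \<Omega>[inf at_top (principal monogenic_params)](\<lambda>a. of_int a powr (2 * \<delta> / 3))"
      by (simp add: bigomega_iff_bigo)
  qed
qed

end
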